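(* There exist paths $\alpha,\beta,\gamma:[0,1]\to\mathbb{R}^2$ such that $\alpha$ is tree-like equivalent to $\gamma$, $\beta$ is tree-like equivalent to $\gamma$, but $\alpha$ is not tree-like equivalent to $\beta$. In addition, $\alpha$ and $\beta$ can be chosen to be tree-like reduced paths.
   Context: A path is a continuous function from $[0,1]$ to a metric space; $\mathbb{R}^2$ carries the Euclidean metric. For a path $\beta$, $\overline{\beta}(t)=\beta(1-t)$ is the reverse path, and $\alpha*\overline{\beta}$ denotes the usual concatenation (defined when $\alpha(1)=\beta(1)$; $\alpha$ is traversed on $[0,\tfrac12]$ and $\overline\beta$ on $[\tfrac12,1]$). Tree-like: a continuous function $\alpha:[0,1]\to X$ into a metric space $(X,d)$ is tree-like if there exists a continuous function $h:[0,1]\to\mathbb{R}$ with $h\ge 0$ and $h(0)=h(1)=0$ such that for all $s\le t$ in $[0,1]$, $$d\big(\alpha(t),\alpha(s)\big)\le h(t)+h(s)-2\inf_{u\in[s,t]}h(u).$$ Such an $h$ is called a height function for $\alpha$. (No Lipschitz or bounded variation condition is imposed on $h$.) Tree-like equivalent: two paths $\alpha,\beta:[0,1]\to X$ are tree-like equivalent if $\alpha*\overline{\beta}$ is defined and tree-like. Tree-like reduced: a path $\alpha:[0,1]\to X$ is tree-like reduced if there are no $0\le s<t\le 1$ such that the restriction $\alpha|_{[s,t]}$, linearly reparametrized to $[0,1]$, is tree-like. *)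

theory Defs
  imports "HOL-Analysis.Analysis"
begin

(* A path is a function on all of real of which only the restriction to [0,1] matters
   (path: continuity on {0..1}). *)

(* No Lipschitz or bounded variation condition is imposed on h. *)
definition height_function :: "(real \<Rightarrow> real) \<Rightarrow> (real \<Rightarrow> 'a::metric_space) \<Rightarrow> bool" where
  "height_function h \<alpha> \<longleftrightarrow>
     continuous_on {0..1} h \<and> (\<forall>t\<in>{0..1}. h t \<ge> 0) \<and> h 0 = 0 \<and> h 1 = 0 \<and>
     (\<forall>s t. 0 \<le> s \<and> s \<le> t \<and> t \<le> 1 \<longrightarrow>
        dist (\<alpha> t) (\<alpha> s) \<le> h t + h s - 2 * (INF u\<in>{s..t}. h u))"

definition tree_like :: "(real \<Rightarrow> 'a::metric_space) \<Rightarrow> bool" where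
  "tree_like \<alpha> \<longleftrightarrow> path \<alpha> \<and> (\<exists>h. height_function h \<alpha>)"

(* The endpoint condition says that the concatenation is defined; +++ itself is total. *)
definition tree_like_equivalent ::
  "(real \<Rightarrow> 'a::metric_space) \<Rightarrow> (real \<Rightarrow> 'a) \<Rightarrow> bool" where
  "tree_like_equivalent \<alpha> \<beta> \<longleftrightarrow>
     path \<alpha> \<and> path \<beta> \<and> pathfinish \<alpha> = pathfinish \<beta> \<and> tree_like (\<alpha> +++ reversepath \<beta>)"

(* The function tested below is subpath s t \<alpha>, unfolded because subpath is restricted to
   real normed vector spaces. *)
definition tree_like_reduced :: "(real \<Rightarrow> 'a::metric_space) \<Rightarrow> bool" where
  "tree_like_reduced \<alpha> \<longleftrightarrow>
     path \<alpha> \<and> \<not> (\<exists>s t. 0 \<le> s \<and> s < t \<and> t \<le> 1 \<and> tree_like (\<lambda>x. \<alpha> ((t - s) * x + s)))"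

end

(* Let gamma be Polya's space-filling curve of the right isosceles triangle with hypotenuse from
   0 to 1 and apex c = (1 + i)/2: the concatenation of copies of itself for the two triangles cut
   off by the altitude, whose hypotenuses are the legs of the big triangle. Hence, if gamma is
   tree-like equivalent to its hypotenuse, it is also tree-like equivalent to the two legs. On the
   other hand gamma consists of four half-sized copies along 0, 1/2, c, 1/2, 1, a polygon that is the
   hypotenuse with the spike from 1/2 to c inserted. Iterating, gamma is the hypotenuse with spikes
   of geometrically decreasing length inserted, so it is tree-like equivalent to the hypotenuse.
   But hypotenuse and legs are arcs (hence reduced) bounding a triangle, and a simple closed curve
   is not tree-like. All estimates for the self-similar gamma and its height are proved by showing
   that an error e improves to e/2. *)

theory Submission
  imports Defs
begin

subsection \<open>Height functions\<close>

text \<open>An infimum lies below each of its values, so a value at one point of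
  \<open>{s..t}\<close> suffices, and letting \<open>e\<close> tend to 0 removes the slack. The
  slack is allowed because the self-similar estimates below hold only up to arbitrarily small
  errors.\<close>

lemma height_functionI:
  fixes \<alpha> :: "real \<Rightarrow> 'a::metric_space"
  assumes cont: "continuous_on {0..1} h" and nonneg: "\<And>t. t \<in> {0..1} \<Longrightarrow> h t \<ge> 0"
    and ends: "h 0 = 0" "h 1 = 0"
    and approx: "\<And>s t e. \<lbrakk>0 \<le> s; s \<le> t; t \<le> 1; 0 < e\<rbrakk> \<Longrightarrow>
       \<exists>u\<in>{s..t}. dist (\<alpha> s) (\<alpha> t) \<le> h s + h t - 2 * h u + e"
  shows "height_function h \<alpha>"
proof -
  have "dist (\<alpha> t) (\<alpha> s) \<le> h t + h s - 2 * (INF u\<in>{s..t}. h u)"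
    if st: "0 \<le> s" "s \<le> t" "t \<le> 1" for s t
  proof (rule field_le_epsilon)
    fix e :: real assume "0 < e"
    then obtain u where u: "u \<in> {s..t}" "dist (\<alpha> s) (\<alpha> t) \<le> h s + h t - 2 * h u + e"
      using approx st by blast
    have "bdd_below (h ` {s..t})"
      using nonneg st by (intro bdd_belowI2[of _ 0]) auto
    then have "(INF u\<in>{s..t}. h u) \<le> h u"
      using u(1) by (rule cINF_lower)
    then show "dist (\<alpha> t) (\<alpha> s) \<le> h t + h s - 2 * (INF u\<in>{s..t}. h u) + e"
      using u(2) by (simp add: dist_commute)
  qed
  then show ?thesis
    unfolding height_function_def using cont nonneg ends by (intro conjI ballI allI impI) simp_all
qed

text \<open>Continuity on a compact interval makes the infimum a minimum, so this direction carries
  no error term.\<close>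

lemma height_functionD:
  fixes \<alpha> :: "real \<Rightarrow> 'a::metric_space"
  assumes h: "height_function h \<alpha>" and st: "0 \<le> s" "s \<le> t" "t \<le> 1"
  shows "\<exists>u\<in>{s..t}. dist (\<alpha> s) (\<alpha> t) \<le> h s + h t - 2 * h u"
proof -
  have "continuous_on {0..1} h"
    using h by (simp add: height_function_def)
  then have "continuous_on {s..t} h"
    using st by (auto intro: continuous_on_subset)
  then obtain u where u: "u \<in> {s..t}" "\<And>v. v \<in> {s..t} \<Longrightarrow> h u \<le> h v"
    using continuous_attains_inf[of "{s..t}" h] st by auto
  have "(INF v\<in>{s..t}. h v) = h u"
    using u by (intro cInf_eq_minimum) auto
  moreover have "dist (\<alpha> t) (\<alpha> s) \<le> h t + h s - 2 * (INF v\<in>{s..t}. h v)"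
    using h st by (simp add: height_function_def)
  ultimately show ?thesis
    using u(1) by (intro bexI[of _ u]) (simp_all add: dist_commute)
qed

lemma tree_like_imp_closed:
  assumes "tree_like \<alpha>"
  shows "\<alpha> 0 = \<alpha> 1"
proof -
  obtain h where h: "height_function h \<alpha>"
    using assms tree_like_def by blast
  obtain u where u: "u \<in> {0..1}" "dist (\<alpha> 0) (\<alpha> 1) \<le> h 0 + h 1 - 2 * h u"
    using height_functionD[OF h, of 0 1] by auto
  have "h 0 = 0" "h 1 = 0" "h u \<ge> 0"
    using h u(1) by (simp_all add: height_function_def)
  then have "dist (\<alpha> 0) (\<alpha> 1) \<le> 0" using u(2) by linarith
  then show ?thesis by simp
qed

section \<open>Arcs and simple closed curves\<close>

text \<open>A tree-like piece takes the same value at both ends, which injectivity forbids.\<close>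

lemma arc_imp_tree_like_reduced:
  fixes \<alpha> :: "real \<Rightarrow> 'a::metric_space"
  assumes "arc \<alpha>"
  shows "tree_like_reduced \<alpha>"
  unfolding tree_like_reduced_def
proof (intro conjI notI; (elim exE conjE)?)
  show "path \<alpha>" using assms by (rule arc_imp_path)
next
  fix s t :: real
  assume st: "0 \<le> s" "s < t" "t \<le> 1" "tree_like (\<lambda>x. \<alpha> ((t - s) * x + s))"
  then have "\<alpha> s = \<alpha> t"
    using tree_like_imp_closed[OF st(4)] by simp
  moreover have "inj_on \<alpha> {0..1}" "s \<in> {0..1}" "t \<in> {0..1}"
    using assms st by (auto simp: arc_def)
  ultimately show False
    using st(2) by (auto dest: inj_onD)
qed

text \<open>Two times of equal height \<open>c\<close> with \<open>h\<close> at least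
  \<open>c\<close> in between have the same image. For \<open>c\<close> strictly between 0 and the
  maximum of \<open>h\<close> such times can be found that are distinct and interior.\<close>

lemma simple_path_imp_not_tree_like:
  fixes \<alpha> :: "real \<Rightarrow> 'a::metric_space"
  assumes "simple_path \<alpha>"
  shows "\<not> tree_like \<alpha>"
proof
  assume "tree_like \<alpha>"
  then obtain h where h: "height_function h \<alpha>"
    using tree_like_def by blast
  have cont: "continuous_on {0..1} h" and nonneg: "\<And>t. t \<in> {0..1} \<Longrightarrow> h t \<ge> 0"
    and ends: "h 0 = 0" "h 1 = 0"
    using h unfolding height_function_def by auto
  have loop_free: "x = y \<or> x = 0 \<and> y = 1 \<or> x = 1 \<and> y = 0"
    if "x \<in> {0..1}" "y \<in> {0..1}" "\<alpha> x = \<alpha> y" for x y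
    using assms that unfolding simple_path_def loop_free_def by blast
  obtain m where m: "m \<in> {0..1}" "\<And>t. t \<in> {0..1} \<Longrightarrow> h t \<le> h m"
    using continuous_attains_sup[OF compact_Icc _ cont] by auto
  obtain u where u: "u \<in> {0..1/2}" "dist (\<alpha> 0) (\<alpha> (1/2)) \<le> h 0 + h (1/2) - 2 * h u"
    using height_functionD[OF h, of 0 "1/2"] by auto
  \<comment> \<open>The path is not constant, so \<open>h\<close> is not identically zero and has a
    positive maximum.\<close>
  have "\<alpha> 0 \<noteq> \<alpha> (1/2)"
    using loop_free[of 0 "1/2"] by auto
  then have "dist (\<alpha> 0) (\<alpha> (1/2)) > 0" by simp
  moreover have "h u \<ge> 0" using u(1) by (intro nonneg) auto
  ultimately have "h (1/2) > 0" using u(2) ends by linarith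
  then have "h m > 0" using m(2)[of "1/2"] by simp
  define c where "c = h m / 2"
  have c: "0 < c" "c < h m" using \<open>h m > 0\<close> by (auto simp: c_def)
  have m01: "0 \<le> m" "m \<le> 1" using m by auto
  txt \<open>The excursion of the height above the level \<open>c\<close> around \<open>m\<close> yields a proper subloop.\<close>
  let ?S = "{x \<in> {0..m}. h x = c}" and ?T = "{x \<in> {m..1}. h x = c}"
  have cm: "continuous_on {0..m} h" "continuous_on {m..1} h"
    using cont m01 by (auto intro: continuous_on_subset)
  have "closed ?S" "closed ?T"
    by (intro continuous_closed_preimage_constant cm closed_atLeastAtMost)+
  moreover have "bounded ?S" "bounded ?T"
    by (rule bounded_subset[OF bounded_closed_interval], blast)+
  ultimately have comp: "compact ?S" "compact ?T"
    by (simp_all add: compact_eq_bounded_closed)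
  obtain x where "0 \<le> x" "x \<le> m" "h x = c"
    using IVT'[of h 0 c m] c m01 cm(1) ends by auto
  then have S: "?S \<noteq> {}" by auto
  obtain y where "m \<le> y" "y \<le> 1" "h y = c"
    using IVT2'[of h 1 c m] c m01 cm(2) ends by auto
  then have T: "?T \<noteq> {}" by auto
  obtain s where s: "s \<in> ?S" "\<And>x. x \<in> ?S \<Longrightarrow> x \<le> s"
    using compact_attains_sup[OF comp(1) S] by blast
  obtain t where t: "t \<in> ?T" "\<And>x. x \<in> ?T \<Longrightarrow> t \<le> x"
    using compact_attains_inf[OF comp(2) T] by blast
  \<comment> \<open>\<open>s\<close> is the last time up to \<open>m\<close>, and \<open>t\<close>
    the first time from \<open>m\<close> on, at level \<open>c\<close>. A dip below \<open>c\<close>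
    between them would force another crossing closer to \<open>m\<close>.\<close>
  have ge: "c \<le> h v" if v: "v \<in> {s..t}" for v
  proof (rule ccontr)
    assume less: "\<not> c \<le> h v"
    show False
    proof (cases "v \<le> m")
      case True
      have "continuous_on {v..m} h"
        using cm(1) s v True by (auto intro: continuous_on_subset)
      then obtain x where x: "v \<le> x" "x \<le> m" "h x = c"
        using IVT'[of h v c m] less c True by auto
      then have "x \<le> s" using s(1) v by (intro s(2)) simp
      then have "x = v" using x(1) v by simp
      then show False using x(3) less by simp
    next
      case False
      have "continuous_on {m..v} h"
        using cm(2) t v False by (auto intro: continuous_on_subset)
      then obtain x where x: "m \<le> x" "x \<le> v" "h x = c"
        using IVT2'[of h v c m] less c False by auto
      then have "t \<le> x" using t(1) v by (intro t(2)) simp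
      then have "x = v" using x(2) v by simp
      then show False using x(3) less by simp
    qed
  qed
  have st: "0 \<le> s" "s \<le> m" "h s = c" "m \<le> t" "t \<le> 1" "h t = c"
    using s t by auto
  have "s \<le> t" using st(2,4) by linarith
  then obtain u where u: "u \<in> {s..t}" "dist (\<alpha> s) (\<alpha> t) \<le> h s + h t - 2 * h u"
    using height_functionD[OF h st(1) _ st(5)] by blast
  then have "dist (\<alpha> s) (\<alpha> t) \<le> 0" using ge[OF u(1)] st(3,6) by linarith
  then have "s = t \<or> s = 0 \<and> t = 1 \<or> s = 1 \<and> t = 0"
    using loop_free[of s t] st by auto
  \<comment> \<open>\<open>s = t\<close> would make both equal to \<open>m\<close>, whose height
    exceeds \<open>c\<close>; the endpoints 0 and 1 have height 0, which is less than
    \<open>c\<close>.\<close>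
  then show False using c ends st by auto
qed

section \<open>Lipschitz images and the gluing of heights\<close>

text \<open>The height scaled by \<open>L\<close> works for \<beta>. Comparing distances instead of
  composing with a map covers Lipschitz images as well as the way back along an isometry.\<close>

lemma tree_like_dominated:
  fixes \<alpha> :: "real \<Rightarrow> 'a::metric_space" and \<beta> :: "real \<Rightarrow> 'b::metric_space"
  assumes "tree_like \<alpha>" "path \<beta>" "L \<ge> 0"
    and le: "\<And>s t. \<lbrakk>s \<in> {0..1}; t \<in> {0..1}\<rbrakk> \<Longrightarrow> dist (\<beta> s) (\<beta> t) \<le> L * dist (\<alpha> s) (\<alpha> t)"
  shows "tree_like \<beta>"
proof -
  obtain h where h: "height_function h \<alpha>"
    using assms tree_like_def by blast
  have "height_function (\<lambda>t. L * h t) \<beta>"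
  proof (rule height_functionI)
    fix s t e :: real
    assume *: "0 \<le> s" "s \<le> t" "t \<le> 1" "0 < e"
    obtain u where u: "u \<in> {s..t}" "dist (\<alpha> s) (\<alpha> t) \<le> h s + h t - 2 * h u"
      using height_functionD[OF h *(1-3)] by blast
    have "dist (\<beta> s) (\<beta> t) \<le> L * dist (\<alpha> s) (\<alpha> t)"
      using le * by simp
    also have "\<dots> \<le> L * (h s + h t - 2 * h u)"
      using u \<open>L \<ge> 0\<close> by (intro mult_left_mono)
    finally show "\<exists>u\<in>{s..t}. dist (\<beta> s) (\<beta> t) \<le> L * h s + L * h t - 2 * (L * h u) + e"
      using u(1) \<open>0 < e\<close> by (intro bexI[of _ u]) (auto simp: algebra_simps)
  next
    show "continuous_on {0..1} (\<lambda>t. L * h t)"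
      using h by (intro continuous_on_mult_left) (simp add: height_function_def)
  qed (use h \<open>L \<ge> 0\<close> in \<open>simp_all add: height_function_def\<close>)
  then show ?thesis using \<open>path \<beta>\<close> tree_like_def by blast
qed

lemma path_cong_01:
  assumes "path \<alpha>" "\<And>t. t \<in> {0..1} \<Longrightarrow> \<beta> t = \<alpha> t"
  shows "path \<beta>"
  using assms path_eq by metis

text \<open>Agreement with the images is asked for on \<open>{0..1}\<close> only, the range on which
  the self-similarity of the curve holds. With the identity as \<open>f\<close>, the lemma exchanges
  paths that agree there.\<close>

lemma tree_like_equivalent_image:
  fixes f :: "'a::metric_space \<Rightarrow> 'b::metric_space"
  assumes eq: "tree_like_equivalent \<alpha> \<gamma>" and f: "L-lipschitz_on UNIV f"
    and \<alpha>': "\<And>t. t \<in> {0..1} \<Longrightarrow> \<alpha>' t = f (\<alpha> t)" and \<gamma>': "\<And>t. t \<in> {0..1} \<Longrightarrow> \<gamma>' t = f (\<gamma> t)"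
  shows "tree_like_equivalent \<alpha>' \<gamma>'"
proof -
  have fin: "pathfinish \<alpha> = pathfinish \<gamma>" and tl: "tree_like (\<alpha> +++ reversepath \<gamma>)"
    and paths: "path \<alpha>" "path \<gamma>"
    using eq tree_like_equivalent_def by blast+
  have cont: "continuous_on A f" for A
    using lipschitz_on_continuous_on[OF f] continuous_on_subset by blast
  have paths': "path \<alpha>'" "path \<gamma>'"
    using path_cong_01[OF path_continuous_image[OF paths(1) cont], of \<alpha>']
      path_cong_01[OF path_continuous_image[OF paths(2) cont], of \<gamma>'] \<alpha>' \<gamma>' by simp_all
  have fin': "pathfinish \<alpha>' = pathfinish \<gamma>'"
    using fin \<alpha>' \<gamma>' by (simp add: pathfinish_def)
  have vals: "(\<alpha>' +++ reversepath \<gamma>') t = f ((\<alpha> +++ reversepath \<gamma>) t)" if "t \<in> {0..1}" for t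
    using that \<alpha>' \<gamma>' by (simp add: joinpaths_def reversepath_def)
  have "tree_like (\<alpha>' +++ reversepath \<gamma>')"
    using tl
  proof (rule tree_like_dominated)
    show "path (\<alpha>' +++ reversepath \<gamma>')"
      using paths' fin' by simp
    show "0 \<le> L" using f by (rule lipschitz_on_nonneg)
  qed (simp add: vals lipschitz_onD[OF f])
  then show ?thesis
    using paths' fin' tree_like_equivalent_def by blast
qed

text \<open>A height along \<alpha> and one along \<gamma> are glued at their common final value:
  \<open>A\<close> is run forwards and then \<open>F\<close> backwards. This describes two branches
  of one tree with a common root and a common end.\<close>

lemma tree_like_equivalentI:
  fixes \<alpha> \<gamma> :: "real \<Rightarrow> 'a::metric_space"
  assumes paths: "path \<alpha>" "path \<gamma>" "pathfinish \<alpha> = pathfinish \<gamma>"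
    and cont: "continuous_on {0..1} A" "continuous_on {0..1} F"
    and nonneg: "\<And>t. t \<in> {0..1} \<Longrightarrow> 0 \<le> A t" "\<And>t. t \<in> {0..1} \<Longrightarrow> 0 \<le> F t"
    and ends: "A 0 = 0" "F 0 = 0" "A 1 = F 1"
    and \<alpha>: "\<And>s t e. \<lbrakk>0 \<le> s; s \<le> t; t \<le> 1; 0 < e\<rbrakk> \<Longrightarrow>
       \<exists>u\<in>{s..t}. dist (\<alpha> s) (\<alpha> t) \<le> A s + A t - 2 * A u + e"
    and \<gamma>: "\<And>s t e. \<lbrakk>0 \<le> s; s \<le> t; t \<le> 1; 0 < e\<rbrakk> \<Longrightarrow>
       \<exists>u\<in>{s..t}. dist (\<gamma> s) (\<gamma> t) \<le> F s + F t - 2 * F u + e"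
    and \<alpha>\<gamma>: "\<And>s t e. \<lbrakk>s \<in> {0..1}; t \<in> {0..1}; 0 < e\<rbrakk> \<Longrightarrow>
       \<exists>m \<in> A ` {s..1} \<union> F ` {t..1}. dist (\<alpha> s) (\<gamma> t) \<le> A s + F t - 2 * m + e"
  shows "tree_like_equivalent \<alpha> \<gamma>"
proof -
  let ?h = "A +++ reversepath F" and ?c = "\<alpha> +++ reversepath \<gamma>"
  have h: "?h t = A (2 * t)" "?c t = \<alpha> (2 * t)" if "t \<le> 1/2" for t
    using that by (simp_all add: joinpaths_def)
  \<comment> \<open>At \<open>t = 1/2\<close> the operator \<open>+++\<close> takes its first
    branch; \<open>A 1 = F 1\<close> and the common endpoint make the second formulas valid there
    too.\<close>
  have h': "?h t = F (2 - 2 * t)" "?c t = \<gamma> (2 - 2 * t)" if "t \<ge> 1/2" for t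
  proof -
    have "?h t = F (2 - 2 * t) \<and> ?c t = \<gamma> (2 - 2 * t)"
    proof (cases "t = 1/2")
      case True
      show ?thesis unfolding True using ends paths(3) by (simp add: joinpaths_def pathfinish_def)
    qed (use that in \<open>simp add: joinpaths_def reversepath_def\<close>)
    then show "?h t = F (2 - 2 * t)" "?c t = \<gamma> (2 - 2 * t)" by auto
  qed
  have "path ?h"
    using cont ends
    by (intro path_join_imp) (simp_all add: path_def[symmetric], simp add: pathfinish_def)
  have "height_function ?h ?c"
  proof (rule height_functionI)
    show "continuous_on {0..1} ?h"
      using \<open>path ?h\<close> by (simp add: path_def)
    show "?h t \<ge> 0" if "t \<in> {0..1}" for t
      using that nonneg(1)[of "2 * t"] nonneg(2)[of "2 - 2 * t"]
      by (cases "t \<le> 1/2") (simp_all add: h h')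
    show "?h 0 = 0" "?h 1 = 0"
      using h(1)[of 0] h'(1)[of 1] ends by simp_all
  next
    fix s t e :: real
    assume st: "0 \<le> s" "s \<le> t" "t \<le> 1" and "0 < e"
    consider "t \<le> 1/2" | "1/2 \<le> s" | "s \<le> 1/2" "1/2 \<le> t" by linarith
    then show "\<exists>u\<in>{s..t}. dist (?c s) (?c t) \<le> ?h s + ?h t - 2 * ?h u + e"
    proof cases
      case 1
      obtain u where "u \<in> {2 * s .. 2 * t}"
        "dist (\<alpha> (2 * s)) (\<alpha> (2 * t)) \<le> A (2 * s) + A (2 * t) - 2 * A u + e"
        using \<alpha>[of "2 * s" "2 * t" e] st 1 \<open>0 < e\<close> by auto
      then show ?thesis
        using st 1 by (intro bexI[of _ "u/2"]) (simp_all add: h)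
    next
      case 2
      obtain u where "u \<in> {2-2 * t .. 2-2 * s}"
        "dist (\<gamma> (2-2 * t)) (\<gamma> (2-2 * s)) \<le> F (2-2 * t) + F (2-2 * s) - 2 * F u + e"
        using \<gamma>[of "2-2 * t" "2-2 * s" e] st 2 \<open>0 < e\<close> by auto
      then show ?thesis
        using st 2 by (intro bexI[of _ "1-u/2"]) (simp_all add: h' dist_commute)
    next
      \<comment> \<open>Between \<open>s\<close> and \<open>t\<close> the concatenation runs through
        \<open>{2 * s..1}\<close> on \<alpha> and then backwards through
        \<open>{2 - 2 * t..1}\<close> on \<gamma>; these are the two ranges in which
        \<open>m\<close> may be attained.\<close>
      case 3
      have "2 * s \<in> {0..1}" "2-2 * t \<in> {0..1}" using st 3 by simp_all
      from \<alpha>\<gamma>[OF this \<open>0 < e\<close>]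
      obtain m where m: "m \<in> A ` {2 * s .. 1} \<union> F ` {2-2 * t .. 1}"
        and le: "dist (\<alpha> (2 * s)) (\<gamma> (2-2 * t)) \<le> A (2 * s) + F (2-2 * t) - 2 * m + e" by blast
      from m have "\<exists>u\<in>{s..t}. ?h u = m"
      proof
        assume "m \<in> A ` {2 * s .. 1}"
        then obtain u where "u \<in> {2 * s .. 1}" "m = A u" by blast
        then show ?thesis using 3 by (intro bexI[of _ "u/2"]) (simp_all add: h)
      next
        assume "m \<in> F ` {2-2 * t .. 1}"
        then obtain u where "u \<in> {2-2 * t .. 1}" "m = F u" by blast
        then show ?thesis using 3 by (intro bexI[of _ "1-u/2"]) (simp_all add: h')
      qed
      then obtain u where "u \<in> {s .. t}" "?h u = m" by blast
      then show ?thesis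
        using le 3 by (intro bexI[of _ u]) (simp_all add: h h')
    qed
  qed
  moreover have "path ?c" using paths by simp
  ultimately show ?thesis
    using paths by (auto simp: tree_like_equivalent_def tree_like_def)
qed

section \<open>Inserting loops and joining equivalences\<close>

lemma height_function_dist_ends:
  assumes h: "height_function h \<alpha>" and t: "t \<in> {0..1}"
  shows "dist (\<alpha> 0) (\<alpha> t) \<le> h t" "dist (\<alpha> t) (\<alpha> 1) \<le> h t"
proof -
  have ends: "h 0 = 0" "h 1 = 0" and nonneg: "\<And>u. u \<in> {0 .. 1} \<Longrightarrow> 0 \<le> h u"
    using h by (simp_all add: height_function_def)
  obtain u where u: "u \<in> {0 .. t}" "dist (\<alpha> 0) (\<alpha> t) \<le> h 0 + h t - 2 * h u"
    using height_functionD[OF h, of 0 t] t by auto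
  have "0 \<le> h u" using u(1) t by (intro nonneg) simp
  then show "dist (\<alpha> 0) (\<alpha> t) \<le> h t" using u(2) ends by linarith
  obtain v where v: "v \<in> {t..1}" "dist (\<alpha> t) (\<alpha> 1) \<le> h t + h 1 - 2 * h v"
    using height_functionD[OF h, of t 1] t by auto
  have "0 \<le> h v" using v(1) t by (intro nonneg) simp
  then show "dist (\<alpha> t) (\<alpha> 1) \<le> h t" using v(2) ends by linarith
qed

text \<open>Grafting a tree onto the point of another tree that is reached at time 1/2 gives a tree
  again, and \<open>c\<close> walks around it.\<close>

lemma height_function_insert_loop:
  fixes a b c :: "real \<Rightarrow> 'a::metric_space"
  assumes f: "height_function f a" and g: "height_function g b" and ab: "a (1/2) = b 0"
    and c1: "\<And>t. \<lbrakk>0 \<le> t; t \<le> 1/4\<rbrakk> \<Longrightarrow> c t = a (2 * t)"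
    and c2: "\<And>t. \<lbrakk>1/4 \<le> t; t \<le> 3/4\<rbrakk> \<Longrightarrow> c t = b (2 * t - 1/2)"
    and c3: "\<And>t. \<lbrakk>3/4 \<le> t; t \<le> 1\<rbrakk> \<Longrightarrow> c t = a (2 * t - 1)"
  shows "\<exists>h. height_function h c"
proof -
  have fcont: "continuous_on {0..1} f" and fnn: "\<And>t. t \<in> {0..1} \<Longrightarrow> f t \<ge> 0"
    and f0: "f 0 = 0" "f 1 = 0"
    using f by (simp_all add: height_function_def)
  have gcont: "continuous_on {0..1} g" and gnn: "\<And>t. t \<in> {0..1} \<Longrightarrow> g t \<ge> 0"
    and g0: "g 0 = 0" "g 1 = 0"
    using g by (simp_all add: height_function_def)
  have ba: "b 1 = a (1/2)"
    using c2[of "3/4"] c3[of "3/4"] by simp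
  \<comment> \<open>During the inserted loop the height of \<open>a\<close> is frozen at
    \<open>f (1/2)\<close> and \<open>g\<close> is added on top; \<open>g\<close> vanishes at both
    ends, so the pieces match.\<close>
  define h where "h t = (if t \<le> 1/4 then f (2 * t) else
    if t \<le> 3/4 then f (1/2) + g (2 * t - 1/2) else f (2 * t - 1))" for t
  have h1: "h t = f (2 * t)" if "t \<le> 1/4" for t
    using that by (simp add: h_def)
  have h2: "h t = f (1/2) + g (2 * t - 1/2)" if "1/4 \<le> t" "t \<le> 3/4" for t
  proof (cases "t = 1/4")
    case True
    show ?thesis unfolding True using g0 by (simp add: h_def)
  qed (use that in \<open>simp add: h_def\<close>)
  have h3: "h t = f (2 * t - 1)" if "3/4 \<le> t" for t
  proof (cases "t = 3/4")
    case True
    show ?thesis unfolding True using g0 by (simp add: h_def)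
  qed (use that in \<open>simp add: h_def\<close>)
  have "height_function h c"
  proof (rule height_functionI)
    have "continuous_on {0..1/4} h \<longleftrightarrow> continuous_on {0..1/4} (\<lambda>t. f (2 * t))"
      by (intro continuous_on_cong) (simp_all add: h1)
    also have "\<dots>"
      by (intro continuous_on_compose2[OF fcont] continuous_intros) auto
    finally have 1: "continuous_on {0..1/4} h" .
    have "continuous_on {1/4..3/4} h \<longleftrightarrow>
        continuous_on {1/4..3/4} (\<lambda>t. f (1/2) + g (2 * t - 1/2))"
      by (intro continuous_on_cong) (simp_all add: h2)
    also have "\<dots>"
      by (intro continuous_on_add continuous_on_const continuous_on_compose2[OF gcont]
          continuous_intros) auto
    finally have 2: "continuous_on {1/4..3/4} h" .
    have "continuous_on {3/4..1} h \<longleftrightarrow> continuous_on {3/4..1} (\<lambda>t. f (2 * t - 1))"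
      by (intro continuous_on_cong) (simp_all add: h3)
    also have "\<dots>"
      by (intro continuous_on_compose2[OF fcont] continuous_intros) auto
    finally have 3: "continuous_on {3/4..1} h" .
    have "continuous_on ({0..1/4} \<union> ({1/4..3/4} \<union> {3/4..1})) h"
      by (intro continuous_on_closed_Un closed_Un closed_atLeastAtMost 1 2 3)
    then show "continuous_on {0..1} h"
      by (rule continuous_on_subset) auto
    show "h t \<ge> 0" if "t \<in> {0..1}" for t
      using that fnn gnn by (auto simp: h_def intro!: add_nonneg_nonneg)
    show "h 0 = 0" "h 1 = 0"
      using f0 by (simp_all add: h_def)
  next
    fix s t e :: real
    assume st: "0 \<le> s" "s \<le> t" "t \<le> 1" and "0 < e"
    consider "t \<le> 1/4" | "s \<le> 1/4" "1/4 \<le> t" "t \<le> 3/4" | "s \<le> 1/4" "3/4 \<le> t"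
      | "1/4 \<le> s" "t \<le> 3/4" | "1/4 \<le> s" "s \<le> 3/4" "3/4 \<le> t" | "3/4 \<le> s"
      by linarith
    then have "\<exists>u\<in>{s..t}. dist (c s) (c t) \<le> h s + h t - 2 * h u"
    proof cases
      case 1
      obtain u where "u \<in> {2 * s .. 2 * t}" "dist (a (2 * s)) (a (2 * t)) \<le> f (2 * s) + f (2 * t) - 2 * f u"
        using height_functionD[OF f, of "2 * s" "2 * t"] st 1 by auto
      then show ?thesis
        using st 1 by (intro bexI[of _ "u/2"]) (simp_all add: h1 c1)
    next
      \<comment> \<open>The way from \<open>c s\<close> to \<open>c t\<close> is split at the
        grafting point: up to there \<open>f\<close> controls the distance, and beyond it the excess
        height \<open>g\<close> does.\<close>
      case 2
      obtain u where u: "u \<in> {2 * s .. 1/2}" "dist (a (2 * s)) (a (1/2)) \<le> f (2 * s) + f (1/2) - 2 * f u"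
        using height_functionD[OF f, of "2 * s" "1/2"] st 2 by auto
      have "dist (c s) (c t) \<le> dist (a (2 * s)) (a (1/2)) + dist (b 0) (b (2 * t-1/2))"
        using st 2 ab dist_triangle[of "a (2 * s)" "b (2 * t-1/2)" "b 0"] by (simp add: c1 c2)
      also have "dist (b 0) (b (2 * t-1/2)) \<le> g (2 * t-1/2)"
        using 2 by (intro height_function_dist_ends[OF g]) simp
      finally show ?thesis
        using u st 2 by (intro bexI[of _ "u/2"]) (simp_all add: h1 h2)
    next
      \<comment> \<open>The inserted loop is skipped: the minimizer \<open>u\<close> of
        \<open>f\<close> belongs to the first or to the last piece of \<open>c\<close>, according to
        its side of 1/2.\<close>
      case 3
      obtain u where u: "u \<in> {2 * s .. 2 * t-1}"
        "dist (a (2 * s)) (a (2 * t-1)) \<le> f (2 * s) + f (2 * t-1) - 2 * f u"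
        using height_functionD[OF f, of "2 * s" "2 * t-1"] st 3 by auto
      show ?thesis
      proof (cases "u \<le> 1/2")
        case True
        then show ?thesis
          using u st 3 by (intro bexI[of _ "u/2"]) (simp_all add: h1 h3 c1 c3)
      next
        case False
        then show ?thesis
          using u st 3 by (intro bexI[of _ "u/2 + 1/2"]) (simp_all add: h1 h3 c1 c3)
      qed
    next
      case 4
      obtain u where "u \<in> {2 * s-1/2 .. 2 * t-1/2}"
        "dist (b (2 * s-1/2)) (b (2 * t-1/2)) \<le> g (2 * s-1/2) + g (2 * t-1/2) - 2 * g u"
        using height_functionD[OF g, of "2 * s-1/2" "2 * t-1/2"] st 4 by auto
      then show ?thesis
        using st 4 by (intro bexI[of _ "u/2+1/4"]) (simp_all add: h2 c2)
    next
      case 5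
      obtain u where u: "u \<in> {1/2 .. 2 * t-1}"
        "dist (a (1/2)) (a (2 * t-1)) \<le> f (1/2) + f (2 * t-1) - 2 * f u"
        using height_functionD[OF f, of "1/2" "2 * t-1"] st 5 by auto
      have "dist (c s) (c t) \<le> dist (b (2 * s-1/2)) (b 1) + dist (a (1/2)) (a (2 * t-1))"
        using st 5 ba dist_triangle[of "b (2 * s-1/2)" "a (2 * t-1)" "b 1"] by (simp add: c2 c3)
      also have "dist (b (2 * s-1/2)) (b 1) \<le> g (2 * s-1/2)"
        using 5 by (intro height_function_dist_ends[OF g]) simp
      finally show ?thesis
        using u st 5 by (intro bexI[of _ "u/2 + 1/2"]) (simp_all add: h2 h3)
    next
      case 6
      obtain u where "u \<in> {2 * s-1 .. 2 * t-1}"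
        "dist (a (2 * s-1)) (a (2 * t-1)) \<le> f (2 * s-1) + f (2 * t-1) - 2 * f u"
        using height_functionD[OF f, of "2 * s-1" "2 * t-1"] st 6 by auto
      then show ?thesis
        using st 6 by (intro bexI[of _ "u/2 + 1/2"]) (simp_all add: h3 c3)
    qed
    then show "\<exists>u\<in>{s..t}. dist (c s) (c t) \<le> h s + h t - 2 * h u + e"
      using \<open>0 < e\<close> by force
  qed
  then show ?thesis by blast
qed

text \<open>The loop to be tested runs through \<open>\<alpha>\<^sub>1\<close>,
  \<open>\<alpha>\<^sub>2\<close>, then backwards through \<open>\<gamma>\<^sub>2\<close> and
  \<open>\<gamma>\<^sub>1\<close>. It is the first loop with the second one inserted at its turning
  point.\<close>

lemma tree_like_equivalent_join:
  fixes \<alpha>\<^sub>1 \<alpha>\<^sub>2 \<gamma>\<^sub>1 \<gamma>\<^sub>2 :: "real \<Rightarrow> 'a::metric_space"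
  assumes eq1: "tree_like_equivalent \<alpha>\<^sub>1 \<gamma>\<^sub>1" and eq2: "tree_like_equivalent \<alpha>\<^sub>2 \<gamma>\<^sub>2"
    and meet: "pathfinish \<alpha>\<^sub>1 = pathstart \<alpha>\<^sub>2"
  shows "tree_like_equivalent (\<alpha>\<^sub>1 +++ \<alpha>\<^sub>2) (\<gamma>\<^sub>1 +++ \<gamma>\<^sub>2)"
proof -
  let ?a = "\<alpha>\<^sub>1 +++ reversepath \<gamma>\<^sub>1" and ?b = "\<alpha>\<^sub>2 +++ reversepath \<gamma>\<^sub>2"
  let ?c = "(\<alpha>\<^sub>1 +++ \<alpha>\<^sub>2) +++ reversepath (\<gamma>\<^sub>1 +++ \<gamma>\<^sub>2)"
  have paths: "path \<alpha>\<^sub>1" "path \<gamma>\<^sub>1" "path \<alpha>\<^sub>2" "path \<gamma>\<^sub>2"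
    and fin: "\<alpha>\<^sub>1 1 = \<gamma>\<^sub>1 1" "\<alpha>\<^sub>2 1 = \<gamma>\<^sub>2 1" and tl: "tree_like ?a" "tree_like ?b"
    using eq1 eq2 by (simp_all add: tree_like_equivalent_def pathfinish_def)
  have "\<alpha>\<^sub>2 0 = \<gamma>\<^sub>2 0"
    using tree_like_imp_closed[OF tl(2)] by (simp add: joinpaths_def reversepath_def)
  \<comment> \<open>A tree-like loop closes up, so the second pair also shares its starting point,
    and the two \<gamma> pieces meet.\<close>
  then have meet': "\<gamma>\<^sub>1 1 = \<gamma>\<^sub>2 0" "\<alpha>\<^sub>1 1 = \<alpha>\<^sub>2 0"
    using meet fin by (simp_all add: pathfinish_def pathstart_def)
  obtain f g where fg: "height_function f ?a" "height_function g ?b"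
    using tl unfolding tree_like_def by blast
  have "\<exists>h. height_function h ?c"
    using fg
  proof (rule height_function_insert_loop)
    show "?a (1/2) = ?b 0"
      using meet' by (simp add: joinpaths_def)
    fix t :: real
    show "?c t = ?a (2 * t)" if "0 \<le> t" "t \<le> 1/4"
      using that by (simp add: joinpaths_def)
    show "?c t = ?b (2 * t - 1/2)" if t: "1/4 \<le> t" "t \<le> 3/4"
    proof -
      \<comment> \<open>At 1/4 and 3/4 the nested \<open>+++\<close> pick different pieces on the
        two sides of the equation; there the meeting conditions are needed.\<close>
      consider "t = 1/4" | "1/4 < t" "t \<le> 1/2" | "1/2 < t" "t < 3/4" | "t = 3/4"
        using t by linarith
      then show ?thesis
      proof cases
        case 1
        show ?thesis unfolding 1 using meet' by (simp add: joinpaths_def)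
      next
        case 4
        show ?thesis unfolding 4 using meet' fin by (simp add: joinpaths_def reversepath_def)
      qed (simp_all add: joinpaths_def reversepath_def algebra_simps)
    qed
    show "?c t = ?a (2 * t - 1)" if "3/4 \<le> t" "t \<le> 1"
    proof (cases "t = 3/4")
      case True
      show ?thesis unfolding True using fin meet' by (simp add: joinpaths_def reversepath_def)
    qed (use that in \<open>simp add: joinpaths_def reversepath_def algebra_simps\<close>)
  qed
  moreover have "path (\<alpha>\<^sub>1 +++ \<alpha>\<^sub>2)" "path (\<gamma>\<^sub>1 +++ \<gamma>\<^sub>2)"
    using paths meet' by (simp_all add: pathfinish_def pathstart_def)
  moreover have "pathfinish (\<alpha>\<^sub>1 +++ \<alpha>\<^sub>2) = pathfinish (\<gamma>\<^sub>1 +++ \<gamma>\<^sub>2)"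
    using fin by (simp add: pathfinish_def joinpaths_def)
  ultimately show ?thesis
    by (simp add: tree_like_equivalent_def tree_like_def)
qed

subsection \<open>Self-similar paths\<close>

text \<open>\<open>Q e\<close> stands for an estimate with error \<open>e\<close>. Repeated halving
  reaches \<open>K * (1/2) ^ n\<close>, which drops below any positive error.\<close>

lemma halving_all:
  fixes K e :: real
  assumes start: "Q K" "0 < K" and half: "\<And>e. \<lbrakk>0 < e; Q e\<rbrakk> \<Longrightarrow> Q (e / 2)"
    and mono: "\<And>d e. \<lbrakk>Q d; d \<le> e\<rbrakk> \<Longrightarrow> Q e" and "0 < e"
  shows "Q e"
proof -
  have Q: "Q (K * (1/2) ^ n)" for n
  proof (induction n)
    case (Suc n)
    then show ?case using half[of "K * (1/2) ^ n"] \<open>0 < K\<close> by simp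
  qed (use start in simp)
  obtain n where "(1/2 :: real) ^ n < e / K"
    using real_arch_pow_inv[of "e / K" "1/2"] \<open>0 < e\<close> \<open>0 < K\<close> by auto
  then have "K * (1/2) ^ n \<le> e"
    using \<open>0 < K\<close> by (simp add: field_simps)
  with Q show ?thesis by (rule mono)
qed

text \<open>Banach iteration on paths with prescribed ends. The contraction is stated pointwise
  because the operators used below evaluate their argument at a single time \<open>r\<close> for
  each \<open>t\<close>.\<close>

lemma exists_fixed_path:
  fixes T :: "(real \<Rightarrow> 'a::banach) \<Rightarrow> real \<Rightarrow> 'a"
  assumes c: "0 \<le> c" "c < 1"
    and contr: "\<And>f g t. t \<in> {0..1} \<Longrightarrow> \<exists>r\<in>{0..1}. dist (T f t) (T g t) \<le> c * dist (f r) (g r)"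
    and inv: "\<And>f. \<lbrakk>path f; pathstart f = a; pathfinish f = b\<rbrakk> \<Longrightarrow>
       path (T f) \<and> pathstart (T f) = a \<and> pathfinish (T f) = b"
  obtains f where "path f" "pathstart f = a" "pathfinish f = b"
    "\<And>t. t \<in> {0..1} \<Longrightarrow> f t = T f t"
proof -
  \<comment> \<open>The straight segment is a convenient start, as it has the ends that
    \<open>inv\<close> preserves.\<close>
  define p where "p n = (T ^^ n) (linepath a b)" for n
  have p: "path (p n) \<and> pathstart (p n) = a \<and> pathfinish (p n) = b" for n
    by (induction n) (simp_all add: p_def inv)
  have "continuous_on {0..1} (\<lambda>t. dist (p 1 t) (p 0 t))"
    using p[of 0] p[of 1] by (intro continuous_on_dist) (simp_all add: path_def)
  then have "bounded ((\<lambda>t. dist (p 1 t) (p 0 t)) ` {0..1})"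
    by (intro compact_imp_bounded compact_continuous_image) simp_all
  then obtain M where "\<forall>x \<in> (\<lambda>t. dist (p 1 t) (p 0 t)) ` {0..1}. norm x \<le> M"
    unfolding bounded_iff by blast
  then have M: "dist (p 1 t) (p 0 t) \<le> M" if "t \<in> {0..1}" for t
    using that by force
  have step: "dist (p (Suc n) t) (p n t) \<le> c ^ n * M" if "t \<in> {0..1}" for n t
    using that
  proof (induction n arbitrary: t)
    case 0
    then show ?case using M by simp
  next
    case (Suc n)
    obtain r where "r \<in> {0..1}"
      "dist (T (p (Suc n)) t) (T (p n) t) \<le> c * dist (p (Suc n) r) (p n r)"
      using contr[OF Suc.prems] by blast
    then have "dist (p (Suc (Suc n)) t) (p (Suc n) t) \<le> c * (c ^ n * M)"
      using Suc.IH[of r] c(1) mult_left_mono[of _ _ c] by (force simp: p_def)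
    then show ?case by simp
  qed
  \<comment> \<open>The limit is written as a telescoping series, so that comparison with the
    geometric series \<open>c ^ n * M\<close> gives uniform convergence.\<close>
  define f where "f t = p 0 t + (\<Sum>n. p (Suc n) t - p n t)" for t
  have "uniform_limit {0..1} (\<lambda>n t. \<Sum>i<n. p (Suc i) t - p i t)
      (\<lambda>t. \<Sum>n. p (Suc n) t - p n t) sequentially"
    using step c by (intro Weierstrass_m_test[where M = "\<lambda>n. c ^ n * M"])
      (auto simp: dist_norm intro!: summable_mult2 summable_geometric)
  then have "uniform_limit {0..1} (\<lambda>n t. p 0 t + (\<Sum>i<n. p (Suc i) t - p i t)) f sequentially"
    unfolding f_def by (intro uniform_limit_add uniform_limit_const)
  moreover have "p 0 t + (\<Sum>i<n. p (Suc i) t - p i t) = p n t" for n t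
    using sum_lessThan_telescope[of "\<lambda>i. p i t" n] by simp
  ultimately have lim: "uniform_limit {0..1} p f sequentially"
    by simp
  have ptlim: "(\<lambda>n. p n t) \<longlonglongrightarrow> f t" if "t \<in> {0..1}" for t
    using lim that by (rule tendsto_uniform_limitI)
  show thesis
  proof
    show "path f"
      unfolding path_def using p
      by (intro uniform_limit_theorem[OF _ lim]) (auto simp: path_def)
    have "(\<lambda>n. p n 0) \<longlonglongrightarrow> f 0" "(\<lambda>n. p n 1) \<longlonglongrightarrow> f 1"
      by (intro ptlim; simp)+
    then show "pathstart f = a" "pathfinish f = b"
      using p by (simp_all add: pathstart_def pathfinish_def LIMSEQ_const_iff)
    fix t :: real assume t: "t \<in> {0..1}"
    have "(\<lambda>n. p (Suc n) t) \<longlonglongrightarrow> T f t"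
    proof (rule metric_tendsto_imp_tendsto[OF _ always_eventually])
      \<comment> \<open>The time \<open>r\<close> given by \<open>contr\<close> may vary with
        \<open>n\<close>, so the uniformity of the limit is used here.\<close>
      show "(\<lambda>n. dist (T (p n) t) (T f t)) \<longlonglongrightarrow> 0"
      proof (rule tendstoI)
        fix e :: real assume "0 < e"
        then have "\<forall>\<^sub>F n in sequentially. \<forall>r\<in>{0..1}. dist (p n r) (f r) < e"
          using lim unfolding uniform_limit_iff by blast
        then show "\<forall>\<^sub>F n in sequentially. dist (dist (T (p n) t) (T f t)) 0 < e"
        proof eventually_elim
          case (elim n)
          obtain r where r: "r \<in> {0..1}" "dist (T (p n) t) (T f t) \<le> c * dist (p n r) (f r)"
            using contr[OF t] by blast
          have "c * dist (p n r) (f r) \<le> 1 * dist (p n r) (f r)"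
            using c by (intro mult_right_mono) simp_all
          then show ?case using r elim by force
        qed
      qed
    qed (simp add: p_def)
    then show "f t = T f t"
      using LIMSEQ_unique LIMSEQ_Suc[OF ptlim[OF t]] by blast
  qed
qed

subsection \<open>The curve and its height\<close>

lemma polya_curve_exists:
  obtains \<gamma> :: "real \<Rightarrow> complex" where "path \<gamma>" "\<gamma> 0 = 0" "\<gamma> 1 = 1"
    "\<And>t. \<lbrakk>0 \<le> t; t \<le> 1/2\<rbrakk> \<Longrightarrow> \<gamma> t = (1 + \<i>) / 2 * cnj (\<gamma> (2 * t))"
    "\<And>t. \<lbrakk>0 \<le> t; t \<le> 1\<rbrakk> \<Longrightarrow> \<gamma> (1 - t) = 1 - cnj (\<gamma> t)"
proof -
  \<comment> \<open>The similarity of ratio 1/sqrt 2 that sends the hypotenuse to the leg from 0 to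
    the apex. The conjugation puts the image triangle inside the big one: the apex goes to
    1/2.\<close>
  define S where "S z = (1 + \<i>) / 2 * cnj z" for z
  \<comment> \<open>The second half is the first one reflected in the altitude
    (\<open>1 - cnj z\<close> is the reflection in the line of real part 1/2) and run
    backwards.\<close>
  define T where "T f = (\<lambda>t. S (f t)) +++ reversepath (\<lambda>t. 1 - cnj (S (f t)))"
    for f :: "real \<Rightarrow> complex"
  have S: "dist (S z) (S w) = sqrt 2 / 2 * dist z w" for z w
  proof -
    have "S z - S w = (1 + \<i>) / 2 * cnj (z - w)"
      by (simp add: S_def right_diff_distrib)
    then have "dist (S z) (S w) = cmod (1 + \<i>) / 2 * cmod (z - w)"
      by (simp only: dist_norm norm_mult norm_divide complex_mod_cnj norm_numeral)
    then show ?thesis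
      by (simp add: dist_norm cmod_def[of "1 + \<i>"])
  qed
  have SR: "dist (1 - cnj (S z)) (1 - cnj (S w)) = dist (S z) (S w)" for z w
  proof -
    have "(1 - cnj (S z)) - (1 - cnj (S w)) = cnj (S w - S z)" by simp
    then show ?thesis by (simp add: dist_norm norm_minus_commute del: complex_cnj_diff)
  qed
  obtain \<gamma> where \<gamma>: "path \<gamma>" "pathstart \<gamma> = 0" "pathfinish \<gamma> = 1"
    "\<And>t. t \<in> {0..1} \<Longrightarrow> \<gamma> t = T \<gamma> t"
  proof (rule exists_fixed_path[of "sqrt 2 / 2" T])
    show "sqrt 2 / 2 < 1" using sqrt2_less_2 by simp
  next
    fix f g :: "real \<Rightarrow> complex" and t :: real assume t: "t \<in> {0..1}"
    show "\<exists>r\<in>{0..1}. dist (T f t) (T g t) \<le> sqrt 2 / 2 * dist (f r) (g r)"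
    proof (cases "t \<le> 1/2")
      case True
      then show ?thesis
        using t by (intro bexI[of _ "2 * t"]) (simp_all add: T_def joinpaths_def S)
    next
      case False
      then show ?thesis
        using t by (intro bexI[of _ "1 - (2 * t - 1)"])
          (simp_all add: T_def joinpaths_def reversepath_def SR S)
    qed
  next
    fix f :: "real \<Rightarrow> complex"
    assume f: "path f" "pathstart f = 0" "pathfinish f = 1"
    then have "path (\<lambda>t. S (f t))" "path (\<lambda>t. 1 - cnj (S (f t)))"
      unfolding path_def S_def by (auto intro!: continuous_intros)
    moreover have "S 1 = 1 - cnj (S 1)" "S 0 = 0"
      by (simp_all add: S_def complex_eq_iff)
    ultimately have "path (T f)"
      using f(3) unfolding T_def
      by (intro path_join_imp) (simp_all, simp add: pathfinish_def)
    then show "path (T f) \<and> pathstart (T f) = 0 \<and> pathfinish (T f) = 1"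
      using f \<open>S 0 = 0\<close>
      by (simp add: T_def pathstart_def pathfinish_def joinpaths_def reversepath_def)
  qed simp_all
  have left: "\<gamma> t = S (\<gamma> (2 * t))" if "0 \<le> t" "t \<le> 1/2" for t
    using that \<gamma>(4)[of t] by (simp add: T_def joinpaths_def)
  have right: "\<gamma> (1 - t) = 1 - cnj (\<gamma> t)" if "0 \<le> t" "t < 1/2" for t
    using that \<gamma>(4)[of "1 - t"] left[of t] by (simp add: T_def joinpaths_def reversepath_def)
  \<comment> \<open>At time 1/2 the join takes its first branch, so the symmetry is checked
    directly: the curve is at the apex, which lies on the axis of reflection.\<close>
  have mid: "\<gamma> (1/2) = 1 - cnj (\<gamma> (1/2))"
    using left[of "1/2"] \<gamma>(3) by (simp add: S_def pathfinish_def complex_eq_iff)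
  have "\<gamma> (1 - t) = 1 - cnj (\<gamma> t)" if t: "0 \<le> t" "t \<le> 1" for t
  proof -
    consider "t < 1/2" | "t = 1/2" | "1/2 < t" by linarith
    then show ?thesis
    proof cases
      case 2
      show ?thesis unfolding 2 using mid by simp
    next
      case 3
      then have "\<gamma> t = 1 - cnj (\<gamma> (1 - t))"
        using right[of "1 - t"] t by simp
      then show ?thesis by simp
    qed (use right t in auto)
  qed
  then show thesis
    using that[of \<gamma>] \<gamma> left by (simp add: S_def pathstart_def pathfinish_def)
qed

text \<open>\<open>F t\<close> is the distance from the root 0 to time \<open>t\<close> in the tree obtained from the segment
  \<open>[0, 1]\<close> by iterating the replacement of a segment by itself with a perpendicular spike of half
  its length at the midpoint. The third piece is reversed because it descends the spike.\<close>

lemma hyp_height_exists: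
  obtains F :: "real \<Rightarrow> real" where "path F" "F 0 = 0" "F 1 = 1"
    "\<And>t. \<lbrakk>0 \<le> t; t \<le> 1/4\<rbrakk> \<Longrightarrow> F t = F (4 * t) / 2"
    "\<And>t. \<lbrakk>1/4 \<le> t; t \<le> 1/2\<rbrakk> \<Longrightarrow> F t = (1 + F (4 * t - 1)) / 2"
    "\<And>t. \<lbrakk>1/2 \<le> t; t \<le> 3/4\<rbrakk> \<Longrightarrow> F t = (1 + F (3 - 4 * t)) / 2"
    "\<And>t. \<lbrakk>3/4 \<le> t; t \<le> 1\<rbrakk> \<Longrightarrow> F t = (1 + F (4 * t - 3)) / 2"
proof -
  define T where "T f = ((\<lambda>t. f t / 2) +++ (\<lambda>t. (1 + f t) / 2)) +++
     (reversepath (\<lambda>t. (1 + f t) / 2) +++ (\<lambda>t. (1 + f t) / 2))" for f :: "real \<Rightarrow> real"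
  have T: "T f t = (if t \<le> 1/4 then f (4 * t) / 2 else if t \<le> 1/2 then (1 + f (4 * t - 1)) / 2
     else if t \<le> 3/4 then (1 + f (3 - 4 * t)) / 2 else (1 + f (4 * t - 3)) / 2)" for f t
    by (simp add: T_def joinpaths_def reversepath_def algebra_simps)
  obtain F where F: "path F" "pathstart F = 0" "pathfinish F = 1"
    "\<And>t. t \<in> {0..1} \<Longrightarrow> F t = T F t"
  proof (rule exists_fixed_path[of "1 / 2" T])
    fix f g :: "real \<Rightarrow> real" and t :: real assume t: "t \<in> {0..1}"
    \<comment> \<open>The single time at which \<open>T f t\<close> evaluates \<open>f\<close>;
      every piece of \<open>T\<close> scales by 1/2.\<close>
    define r where "r = (if t \<le> 1/4 then 4 * t else if t \<le> 1/2 then 4 * t - 1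
      else if t \<le> 3/4 then 3 - 4 * t else 4 * t - 3)"
    have eq: "T f t - T g t = (f r - g r) / 2"
      by (simp add: r_def T diff_divide_distrib add_divide_distrib)
    have "r \<in> {0..1}"
      using t by (auto simp: r_def)
    moreover have "dist (T f t) (T g t) = 1 / 2 * dist (f r) (g r)"
      unfolding dist_real_def eq by simp
    ultimately show "\<exists>r\<in>{0..1}. dist (T f t) (T g t) \<le> 1 / 2 * dist (f r) (g r)"
      by (intro bexI[of _ r]) simp_all
  next
    fix f :: "real \<Rightarrow> real"
    assume f: "path f" "pathstart f = 0" "pathfinish f = 1"
    then have "path (\<lambda>t. f t / 2)" "path (\<lambda>t. (1 + f t) / 2)"
      unfolding path_def by (auto intro!: continuous_intros)
    then have "path (T f)"
      using f(2,3) unfolding T_def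
      by (intro path_join_imp) (simp_all, simp_all add: pathfinish_def pathstart_def)
    then show "path (T f) \<and> pathstart (T f) = 0 \<and> pathfinish (T f) = 1"
      using f by (simp add: T_def pathstart_def pathfinish_def joinpaths_def reversepath_def)
  qed simp_all
  have ends: "F 0 = 0" "F 1 = 1"
    using F by (simp_all add: pathstart_def pathfinish_def)
  show thesis
  proof
    fix t :: real
    show "F t = F (4 * t) / 2" if "0 \<le> t" "t \<le> 1/4"
      using that F(4)[of t] by (simp add: T)
    \<comment> \<open>\<open>T\<close> assigns each quarter point to the piece on its left; the
      values of \<open>F\<close> at 0 and 1 make the formula of the next piece agree there.\<close>
    show "F t = (1 + F (4 * t - 1)) / 2" if t: "1/4 \<le> t" "t \<le> 1/2"
    proof (cases "t = 1/4")
      case True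
      show ?thesis unfolding True using F(4)[of "1/4"] ends by (simp add: T)
    qed (use t F(4)[of t] in \<open>simp add: T\<close>)
    show "F t = (1 + F (3 - 4 * t)) / 2" if t: "1/2 \<le> t" "t \<le> 3/4"
    proof (cases "t = 1/2")
      case True
      show ?thesis unfolding True using F(4)[of "1/2"] ends by (simp add: T)
    qed (use t F(4)[of t] in \<open>simp add: T\<close>)
    show "F t = (1 + F (4 * t - 3)) / 2" if t: "3/4 \<le> t" "t \<le> 1"
    proof (cases "t = 3/4")
      case True
      show ?thesis unfolding True using F(4)[of "3/4"] ends by (simp add: T)
    qed (use t F(4)[of t] in \<open>simp add: T\<close>)
  qed (use F ends in simp_all)
qed

text \<open>\<gamma> and \<open>F\<close> are constructed independently; what couples them is that
  both split into half-sized copies over the same four quarters of time.\<close>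

locale polya_curve =
  fixes \<gamma> :: "real \<Rightarrow> complex" and F :: "real \<Rightarrow> real"
  assumes path_\<gamma>: "path \<gamma>" and \<gamma>_ends: "\<gamma> 0 = 0" "\<gamma> 1 = 1"
    and \<gamma>_left: "\<And>t. \<lbrakk>0 \<le> t; t \<le> 1/2\<rbrakk> \<Longrightarrow> \<gamma> t = (1 + \<i>) / 2 * cnj (\<gamma> (2 * t))"
    and \<gamma>_sym: "\<And>t. \<lbrakk>0 \<le> t; t \<le> 1\<rbrakk> \<Longrightarrow> \<gamma> (1 - t) = 1 - cnj (\<gamma> t)"
    and path_F: "path F" and F_ends: "F 0 = 0" "F 1 = 1"
    and F1: "\<And>t. \<lbrakk>0 \<le> t; t \<le> 1/4\<rbrakk> \<Longrightarrow> F t = F (4 * t) / 2"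
    and F2: "\<And>t. \<lbrakk>1/4 \<le> t; t \<le> 1/2\<rbrakk> \<Longrightarrow> F t = (1 + F (4 * t - 1)) / 2"
    and F3: "\<And>t. \<lbrakk>1/2 \<le> t; t \<le> 3/4\<rbrakk> \<Longrightarrow> F t = (1 + F (3 - 4 * t)) / 2"
    and F4: "\<And>t. \<lbrakk>3/4 \<le> t; t \<le> 1\<rbrakk> \<Longrightarrow> F t = (1 + F (4 * t - 3)) / 2"
begin

section \<open>The four half-sized copies\<close>

text \<open>The reflection turns the left copy into the right one run backwards; using the symmetry
  once more inside the copy restores the direction of time.\<close>

lemma \<gamma>_right:
  assumes "1/2 \<le> t" "t \<le> 1"
  shows "\<gamma> t = (1 + \<i>) / 2 + (1 - \<i>) / 2 * cnj (\<gamma> (2 * t - 1))"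
proof -
  have "\<gamma> t = 1 - cnj (\<gamma> (1 - t))"
    using \<gamma>_sym[of "1 - t"] assms by simp
  also have "\<gamma> (1 - t) = (1 + \<i>) / 2 * cnj (\<gamma> (1 - (2 * t - 1)))"
    using \<gamma>_left[of "1 - t"] assms by (simp add: algebra_simps)
  also have "\<gamma> (1 - (2 * t - 1)) = 1 - cnj (\<gamma> (2 * t - 1))"
    using assms by (intro \<gamma>_sym) simp_all
  finally show ?thesis
    by (simp add: complex_eq_iff field_simps)
qed

text \<open>The copies along 0, 1/2, apex, 1/2, 1. In the first two, halving twice cancels the
  conjugations; the third is the second mirrored in the spike and run backwards, and the fourth
  comes from the first by symmetry.\<close>

lemma \<gamma>1: "\<lbrakk>0 \<le> t; t \<le> 1/4\<rbrakk> \<Longrightarrow> \<gamma> t = \<gamma> (4 * t) / 2"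
  using \<gamma>_left[of t] \<gamma>_left[of "2 * t"] by (simp add: complex_eq_iff field_simps)

lemma \<gamma>2: "\<lbrakk>1/4 \<le> t; t \<le> 1/2\<rbrakk> \<Longrightarrow> \<gamma> t = (1 + \<i> * \<gamma> (4 * t - 1)) / 2"
  using \<gamma>_left[of t] \<gamma>_right[of "2 * t"] by (simp add: complex_eq_iff field_simps)

lemma \<gamma>3: "\<lbrakk>1/2 \<le> t; t \<le> 3/4\<rbrakk> \<Longrightarrow> \<gamma> t = (1 + \<i> * cnj (\<gamma> (3 - 4 * t))) / 2"
  using \<gamma>_sym[of "1 - t"] \<gamma>2[of "1 - t"] by (simp add: complex_eq_iff field_simps)

lemma \<gamma>4: "\<lbrakk>3/4 \<le> t; t \<le> 1\<rbrakk> \<Longrightarrow> \<gamma> t = (1 + \<gamma> (4 * t - 3)) / 2"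
  using \<gamma>_sym[of "1 - t"] \<gamma>1[of "1 - t"] \<gamma>_sym[of "4 * t - 3"]
  by (simp add: complex_eq_iff field_simps)

text \<open>The bound provides the initial error for the halving arguments.\<close>

lemma bounded_K:
  obtains K where "0 < K" "\<And>t. t \<in> {0..1} \<Longrightarrow> cmod (\<gamma> t) \<le> K" "\<And>t. t \<in> {0..1} \<Longrightarrow> \<bar>F t\<bar> \<le> K"
proof -
  have "bounded (\<gamma> ` {0..1})" "bounded (F ` {0..1})"
    using bounded_path_image[OF path_\<gamma>] bounded_path_image[OF path_F]
    by (simp_all add: path_image_def)
  then obtain a b where a: "\<forall>z\<in>\<gamma> ` {0..1}. cmod z \<le> a" and b: "\<forall>x\<in>F ` {0..1}. norm x \<le> b"
    unfolding bounded_iff by blast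
  have "cmod (\<gamma> t) \<le> max 1 (max a b)" "\<bar>F t\<bar> \<le> max 1 (max a b)" if "t \<in> {0..1}" for t
    using a b that by (force simp: le_max_iff_disj)+
  then show thesis
    by (intro that[of "max 1 (max a b)"]) simp_all
qed

lemma quarter_cases:
  fixes t :: real
  assumes "t \<in> {0..1}"
  obtains "0 \<le> t" "t \<le> 1/4" | "1/4 \<le> t" "t \<le> 1/2" | "1/2 \<le> t" "t \<le> 3/4" | "3/4 \<le> t" "t \<le> 1"
  using assms by fastforce

section \<open>Comparison of the curve with its tree\<close>

text \<open>The recursion for \<open>F\<close> is the one for \<gamma> with rotations and
  reflections dropped, so the triangle inequality passes the estimate from the copies to the whole
  with half the error.\<close>

lemma norm_le_F:
  assumes "t \<in> {0..1}"
  shows "cmod (\<gamma> t) \<le> F t"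
proof (rule field_le_epsilon)
  fix e :: real assume "0 < e"
  obtain K where K: "0 < K" "\<And>t. t \<in> {0..1} \<Longrightarrow> cmod (\<gamma> t) \<le> K" "\<And>t. t \<in> {0..1} \<Longrightarrow> \<bar>F t\<bar> \<le> K"
    by (rule bounded_K) blast
  have "\<forall>t\<in>{0..1}. cmod (\<gamma> t) \<le> F t + e"
  proof (rule halving_all[where K = "2 * K"])
    show "\<forall>t\<in>{0..1}. cmod (\<gamma> t) \<le> F t + 2 * K"
    proof
      fix t :: real assume "t \<in> {0..1}"
      then show "cmod (\<gamma> t) \<le> F t + 2 * K" using K(2,3)[of t] by linarith
    qed
  next
    fix e assume IH: "\<forall>t\<in>{0..1}. cmod (\<gamma> t) \<le> F t + e"
    have half: "cmod ((1 + z) / 2) \<le> (1 + cmod z) / 2" for z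
      using norm_triangle_ineq[of 1 z] by (simp add: norm_divide)
    show "\<forall>t\<in>{0..1}. cmod (\<gamma> t) \<le> F t + e / 2"
    proof
      fix t :: real assume "t \<in> {0..1}"
      then show "cmod (\<gamma> t) \<le> F t + e / 2"
      proof (cases rule: quarter_cases)
        case 1
        then have "cmod (\<gamma> (4 * t)) \<le> F (4 * t) + e" using IH by simp
        then show ?thesis using 1 by (simp add: \<gamma>1[of t] F1[of t] norm_divide)
      next
        case 2
        then have "cmod (\<gamma> (4 * t - 1)) \<le> F (4 * t - 1) + e" using IH by simp
        then show ?thesis
          using half[of "\<i> * \<gamma> (4 * t - 1)"] unfolding \<gamma>2[OF 2] F2[OF 2]
          by (simp add: norm_mult field_simps)
      next
        case 3
        then have "cmod (\<gamma> (3 - 4 * t)) \<le> F (3 - 4 * t) + e" using IH by simp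
        then show ?thesis
          using half[of "\<i> * cnj (\<gamma> (3 - 4 * t))"] unfolding \<gamma>3[OF 3] F3[OF 3]
          by (simp add: norm_mult field_simps)
      next
        case 4
        then have "cmod (\<gamma> (4 * t - 3)) \<le> F (4 * t - 3) + e" using IH by simp
        then show ?thesis
          using half[of "\<gamma> (4 * t - 3)"] unfolding \<gamma>4[OF 4] F4[OF 4] by (simp add: field_simps)
      qed
    qed
  qed (use K \<open>0 < e\<close> in force)+
  then show "cmod (\<gamma> t) \<le> F t + e" using assms by blast
qed

text \<open>Each of the last three copies is rooted at 1/2, where the height is 1/2, so
  \<open>norm_le_F\<close> applies inside the copy.\<close>

lemma dist_midpoint_le:
  assumes "1/4 \<le> t" "t \<le> 1"
  shows "dist (\<gamma> t) (1/2) \<le> F t - 1/2"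
proof -
  have *: "dist ((1 + z) / 2) (1/2) = cmod z / 2" for z :: complex
    by (simp add: dist_norm add_divide_distrib norm_divide)
  consider "1/4 \<le> t" "t \<le> 1/2" | "1/2 \<le> t" "t \<le> 3/4" | "3/4 \<le> t" "t \<le> 1"
    using assms by linarith
  then show ?thesis
  proof cases
    case 1
    then show ?thesis
      using norm_le_F[of "4 * t - 1"] unfolding \<gamma>2[OF 1] F2[OF 1] * by (simp add: norm_mult field_simps)
  next
    case 2
    then show ?thesis
      using norm_le_F[of "3 - 4 * t"] unfolding \<gamma>3[OF 2] F3[OF 2] * by (simp add: norm_mult field_simps)
  next
    case 3
    then show ?thesis
      using norm_le_F[of "4 * t - 3"] unfolding \<gamma>4[OF 3] F4[OF 3] * by (simp add: field_simps)
  qed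
qed

lemma F_three_quarters: "F (3/4) = 1/2"
  using F4[of "3/4"] F_ends by simp

text \<open>The infimum of \<open>F\<close> over \<open>[t, 1]\<close> is the position on the base segment at which the
  branch of the tree through time \<open>t\<close> is attached.\<close>

lemma dist_base_le:
  assumes "t \<in> {0..1}" "0 < e"
  shows "\<exists>v\<in>{t..1}. dist (\<gamma> t) (of_real (F v)) \<le> F t - F v + e"
proof -
  obtain K where K: "0 < K" "\<And>t. t \<in> {0..1} \<Longrightarrow> cmod (\<gamma> t) \<le> K" "\<And>t. t \<in> {0..1} \<Longrightarrow> \<bar>F t\<bar> \<le> K"
    by (rule bounded_K) blast
  have "\<forall>t\<in>{0..1}. \<exists>v\<in>{t..1}. dist (\<gamma> t) (of_real (F v)) \<le> F t - F v + e"
  proof (rule halving_all[where K = "2 * K"])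
    show "\<forall>t\<in>{0..1}. \<exists>v\<in>{t..1}. dist (\<gamma> t) (of_real (F v)) \<le> F t - F v + 2 * K"
    proof
      fix t :: real assume "t \<in> {0..1}"
      then have "dist (\<gamma> t) (of_real (F t)) \<le> F t - F t + 2 * K"
        using K(2,3)[of t] norm_triangle_ineq4[of "\<gamma> t" "of_real (F t)"]
        by (simp add: dist_norm)
      then show "\<exists>v\<in>{t..1}. dist (\<gamma> t) (of_real (F v)) \<le> F t - F v + 2 * K"
        using \<open>t \<in> {0..1}\<close> by (intro bexI[of _ t]) simp_all
    qed
  next
    fix e :: real
    assume IH: "\<forall>t\<in>{0..1}. \<exists>v\<in>{t..1}. dist (\<gamma> t) (of_real (F v)) \<le> F t - F v + e" and "0 < e"
    show "\<forall>t\<in>{0..1}. \<exists>v\<in>{t..1}. dist (\<gamma> t) (of_real (F v)) \<le> F t - F v + e / 2"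
    proof
      fix t :: real assume "t \<in> {0..1}"
      then consider "0 \<le> t" "t \<le> 1/4" | "1/4 \<le> t" "t \<le> 3/4" | "3/4 \<le> t" "t \<le> 1"
        by fastforce
      then show "\<exists>v\<in>{t..1}. dist (\<gamma> t) (of_real (F v)) \<le> F t - F v + e / 2"
      proof cases
        case 1
        then obtain v where v: "v \<in> {4 * t..1}"
          "dist (\<gamma> (4 * t)) (of_real (F v)) \<le> F (4 * t) - F v + e"
          using bspec[OF IH, of "4 * t"] by auto
        have Fv: "F (v / 4) = F v / 2"
          using F1[of "v / 4"] v(1) 1 by simp
        have "dist (\<gamma> t) (of_real (F (v / 4))) = dist (\<gamma> (4 * t)) (of_real (F v)) / 2"
          unfolding \<gamma>1[OF 1] Fv by (simp add: dist_norm norm_divide flip: diff_divide_distrib)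
        also have "\<dots> \<le> F t - F (v / 4) + e / 2"
          using v(2) unfolding F1[OF 1] Fv by simp
        finally show ?thesis
          using v(1) 1 by (intro bexI[of _ "v / 4"]) simp_all
      next
        case 2
        then show ?thesis
          using dist_midpoint_le[of t] \<open>0 < e\<close>
          by (intro bexI[of _ "3/4"]) (simp_all add: F_three_quarters)
      next
        case 3
        then obtain v where v: "v \<in> {4 * t - 3..1}"
          "dist (\<gamma> (4 * t - 3)) (of_real (F v)) \<le> F (4 * t - 3) - F v + e"
          using bspec[OF IH, of "4 * t - 3"] by auto
        have Fv: "F (v / 4 + 3 / 4) = (1 + F v) / 2"
          using F4[of "v / 4 + 3 / 4"] v(1) 3 by simp
        have "dist (\<gamma> t) (of_real (F (v / 4 + 3 / 4))) = dist (\<gamma> (4 * t - 3)) (of_real (F v)) / 2"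
          unfolding \<gamma>4[OF 3] Fv by (simp add: dist_norm norm_divide flip: diff_divide_distrib)
        also have "\<dots> \<le> F t - F (v / 4 + 3 / 4) + e / 2"
          using v(2) unfolding F4[OF 3] Fv by (simp add: field_simps)
        finally show ?thesis
          using v(1) 3 by (intro bexI[of _ "v / 4 + 3 / 4"]) simp_all
      qed
    qed
  qed (use K \<open>0 < e\<close> in force)+
  then show ?thesis using assms(1) by blast
qed

text \<open>Two times in one copy are handled by recursion. Times in different copies are compared
  through 1/2, except for those on the way up and on the way down the spike, whose attachment points
  on the spike are compared.\<close>

lemma dist_\<gamma>_le:
  assumes "0 \<le> s" "s \<le> t" "t \<le> 1" "0 < e"
  shows "\<exists>u\<in>{s..t}. dist (\<gamma> s) (\<gamma> t) \<le> F s + F t - 2 * F u + e"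
proof -
  define Q where "Q e \<longleftrightarrow> (\<forall>s t. 0 \<le> s \<longrightarrow> s \<le> t \<longrightarrow> t \<le> 1 \<longrightarrow>
    (\<exists>u\<in>{s..t}. dist (\<gamma> s) (\<gamma> t) \<le> F s + F t - 2 * F u + e))" for e
  have QD: "\<exists>u\<in>{s..t}. dist (\<gamma> s) (\<gamma> t) \<le> F s + F t - 2 * F u + e"
    if "Q e" "0 \<le> s" "s \<le> t" "t \<le> 1" for e s t
    using that unfolding Q_def by blast
  obtain K where K: "0 < K" "\<And>t. t \<in> {0..1} \<Longrightarrow> cmod (\<gamma> t) \<le> K" "\<And>t. t \<in> {0..1} \<Longrightarrow> \<bar>F t\<bar> \<le> K"
    by (rule bounded_K) blast
  have "Q e"
  proof (rule halving_all[where K = "4 * K"])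
    show "Q (4 * K)"
      unfolding Q_def
    proof (intro allI impI)
      fix s t :: real assume st: "0 \<le> s" "s \<le> t" "t \<le> 1"
      then have "dist (\<gamma> s) (\<gamma> t) \<le> F s + F t - 2 * F s + 4 * K"
        using K(2,3)[of s] K(2,3)[of t] norm_triangle_ineq4[of "\<gamma> s" "\<gamma> t"]
        by (simp add: dist_norm)
      then show "\<exists>u\<in>{s..t}. dist (\<gamma> s) (\<gamma> t) \<le> F s + F t - 2 * F u + 4 * K"
        using st by (intro bexI[of _ s]) simp_all
    qed
  next
    fix d e :: real assume "Q d" "d \<le> e"
    then show "Q e" unfolding Q_def by (meson add_left_mono order_trans)
  next
    fix e :: real assume "0 < e" "Q e"
    have half: "dist ((1 + z) / 2) ((1 + w) / 2) = dist z w / 2" for z w :: complex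
      by (simp add: dist_norm norm_divide flip: diff_divide_distrib)
    have rot: "dist (\<i> * z) (\<i> * w) = dist z w" for z w
      by (simp add: dist_norm norm_mult flip: right_diff_distrib)
    have refl: "dist (cnj z) (cnj w) = dist z w" for z w
      by (simp add: dist_norm del: complex_cnj_diff flip: complex_cnj_diff)
    show "Q (e / 2)"
      unfolding Q_def
    proof (intro allI impI)
      fix s t :: real assume st: "0 \<le> s" "s \<le> t" "t \<le> 1"
      consider "t \<le> 1/4" | "s \<le> 1/4" "1/4 \<le> t" | "1/4 \<le> s" "t \<le> 1/2"
        | "1/4 \<le> s" "s \<le> 1/2" "1/2 \<le> t" "t \<le> 3/4" | "1/2 \<le> s" "t \<le> 3/4"
        | "1/4 \<le> s" "s \<le> 3/4" "3/4 \<le> t" | "3/4 \<le> s"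
        by linarith
      then show "\<exists>u\<in>{s..t}. dist (\<gamma> s) (\<gamma> t) \<le> F s + F t - 2 * F u + e / 2"
      proof cases
        case 1
        obtain u where u: "u \<in> {4 * s..4 * t}"
          "dist (\<gamma> (4 * s)) (\<gamma> (4 * t)) \<le> F (4 * s) + F (4 * t) - 2 * F u + e"
          using QD[OF \<open>Q e\<close>, of "4 * s" "4 * t"] st 1 by auto
        have "dist (\<gamma> s) (\<gamma> t) = dist (\<gamma> (4 * s)) (\<gamma> (4 * t)) / 2"
          using st 1 by (simp add: \<gamma>1[of s] \<gamma>1[of t] dist_norm norm_divide flip: diff_divide_distrib)
        then show ?thesis
          using u st 1 by (intro bexI[of _ "u / 4"]) (simp_all add: F1[of s] F1[of t] F1[of "u / 4"])
      next
        \<comment> \<open>The end of the first copy is 1/2, where \<gamma> later attaches: recursion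
          up to that point, \<open>dist_midpoint_le\<close> from there on.\<close>
        case 2
        obtain u where u: "u \<in> {4 * s..1}"
          "dist (\<gamma> (4 * s)) (\<gamma> 1) \<le> F (4 * s) + F 1 - 2 * F u + e"
          using QD[OF \<open>Q e\<close>, of "4 * s" 1] st 2 by auto
        have "dist (\<gamma> s) (1/2) = dist (\<gamma> (4 * s)) (\<gamma> 1) / 2"
          using st 2
          by (simp add: \<gamma>1[of s] \<gamma>_ends dist_norm norm_divide flip: diff_divide_distrib)
        then have "dist (\<gamma> s) (1/2) \<le> (F (4 * s) + F 1 - 2 * F u + e) / 2"
          using u(2) by simp
        moreover have "dist (\<gamma> t) (1/2) \<le> F t - 1/2"
          using st 2 by (intro dist_midpoint_le)
        ultimately have "dist (\<gamma> s) (1/2) + dist (\<gamma> t) (1/2) \<le>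
            (F (4 * s) + F 1 - 2 * F u + e) / 2 + (F t - 1/2)"
          by (rule add_mono)
        with dist_triangle2[of "\<gamma> s" "\<gamma> t" "1/2"]
        have "dist (\<gamma> s) (\<gamma> t) \<le> (F (4 * s) + F 1 - 2 * F u + e) / 2 + (F t - 1/2)"
          by (rule order_trans)
        then show ?thesis
          using u(1) st 2 F_ends
          by (intro bexI[of _ "u / 4"]) (simp_all add: F1[of s] F1[of "u / 4"] field_simps)
      next
        case 3
        obtain u where u: "u \<in> {4 * s - 1..4 * t - 1}"
          "dist (\<gamma> (4 * s - 1)) (\<gamma> (4 * t - 1)) \<le> F (4 * s - 1) + F (4 * t - 1) - 2 * F u + e"
          using QD[OF \<open>Q e\<close>, of "4 * s - 1" "4 * t - 1"] st 3 by auto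
        have "dist (\<gamma> s) (\<gamma> t) = dist (\<gamma> (4 * s - 1)) (\<gamma> (4 * t - 1)) / 2"
          using st 3 by (simp add: \<gamma>2[of s] \<gamma>2[of t] half rot)
        then show ?thesis
          using u st 3
          by (intro bexI[of _ "u / 4 + 1 / 4"])
            (simp_all add: F2[of s] F2[of t] F2[of "u / 4 + 1 / 4"] add_divide_distrib)
      next
        case 4
        \<comment> \<open>The matching times in the copy going up and in its mirror image going
          down. Both branches are projected to the spike, whose points are real in the coordinates
          of the copy and hence fixed by \<open>cnj\<close>. Two errors \<open>e / 2\<close> add up
          to \<open>e\<close> and are halved by the scale of the copy.\<close>
        define x y where "x = 4 * s - 1" and "y = 3 - 4 * t"
        have xy: "x \<in> {0..1}" "y \<in> {0..1}" using 4 by (simp_all add: x_def y_def)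
        obtain v where v: "v \<in> {x..1}" "dist (\<gamma> x) (of_real (F v)) \<le> F x - F v + e / 2"
          using dist_base_le[OF xy(1), of "e / 2"] \<open>0 < e\<close> by auto
        obtain w where w: "w \<in> {y..1}" "dist (\<gamma> y) (of_real (F w)) \<le> F y - F w + e / 2"
          using dist_base_le[OF xy(2), of "e / 2"] \<open>0 < e\<close> by auto
        have "dist (of_real (F w)) (cnj (\<gamma> y)) = dist (\<gamma> y) (of_real (F w))"
          using refl[of "of_real (F w)" "\<gamma> y"] by (simp add: dist_commute)
        then have "dist (\<gamma> x) (cnj (\<gamma> y)) \<le>
            dist (\<gamma> x) (of_real (F v)) + dist (F v) (F w) + dist (\<gamma> y) (of_real (F w))"
          using dist_triangle[of "\<gamma> x" "cnj (\<gamma> y)" "of_real (F v)"]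
            dist_triangle[of "of_real (F v)" "cnj (\<gamma> y)" "of_real (F w)"]
          by (simp add: dist_of_real)
        then have "dist (\<gamma> x) (cnj (\<gamma> y)) \<le> F x + F y - 2 * min (F v) (F w) + e"
          using v(2) w(2) by (simp add: dist_real_def)
        moreover have "dist (\<gamma> s) (\<gamma> t) = dist (\<gamma> x) (cnj (\<gamma> y)) / 2"
          unfolding x_def y_def using 4 by (simp add: \<gamma>2[of s] \<gamma>3[of t] half rot)
        moreover have "F s = (1 + F x) / 2" "F t = (1 + F y) / 2"
          using 4 by (simp_all add: x_def y_def F2 F3)
        ultimately have le: "dist (\<gamma> s) (\<gamma> t) \<le> F s + F t - (1 + min (F v) (F w)) + e / 2"
          by simp
        \<comment> \<open>The lower of the two attachment points is visited between \<open>s\<close>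
          and \<open>t\<close>, on the way up or on the way down.\<close>
        show ?thesis
        proof (cases "F v \<le> F w")
          case True
          have "2 * F (v / 4 + 1 / 4) = 1 + F v"
            using F2[of "v / 4 + 1 / 4"] v(1) xy by simp
          then show ?thesis
            using le True v(1) 4 by (intro bexI[of _ "v / 4 + 1 / 4"]) (simp_all add: x_def)
        next
          case False
          have "2 * F (3 / 4 - w / 4) = 1 + F w"
            using F3[of "3 / 4 - w / 4"] w(1) xy by simp
          then show ?thesis
            using le False w(1) 4 by (intro bexI[of _ "3 / 4 - w / 4"]) (simp_all add: y_def)
        qed
      next
        case 5
        obtain u where u: "u \<in> {3 - 4 * t..3 - 4 * s}"
          "dist (\<gamma> (3 - 4 * t)) (\<gamma> (3 - 4 * s)) \<le> F (3 - 4 * t) + F (3 - 4 * s) - 2 * F u + e"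
          using QD[OF \<open>Q e\<close>, of "3 - 4 * t" "3 - 4 * s"] st 5 by auto
        have "dist (\<gamma> s) (\<gamma> t) = dist (\<gamma> (3 - 4 * t)) (\<gamma> (3 - 4 * s)) / 2"
          using st 5 by (simp add: \<gamma>3[of s] \<gamma>3[of t] half rot refl dist_commute)
        then show ?thesis
          using u st 5
          by (intro bexI[of _ "3 / 4 - u / 4"])
            (simp_all add: F3[of s] F3[of t] F3[of "3 / 4 - u / 4"] add_divide_distrib)
      next
        \<comment> \<open>Time 3/4 lies between \<open>s\<close> and \<open>t\<close>; the curve is
          then at 1/2 with height 1/2.\<close>
        case 6
        then show ?thesis
          using dist_midpoint_le[of s] dist_midpoint_le[of t] st \<open>0 < e\<close>
            dist_triangle2[of "\<gamma> s" "\<gamma> t" "1/2"]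
          by (intro bexI[of _ "3/4"]) (simp_all add: F_three_quarters)
      next
        case 7
        obtain u where u: "u \<in> {4 * s - 3..4 * t - 3}"
          "dist (\<gamma> (4 * s - 3)) (\<gamma> (4 * t - 3)) \<le> F (4 * s - 3) + F (4 * t - 3) - 2 * F u + e"
          using QD[OF \<open>Q e\<close>, of "4 * s - 3" "4 * t - 3"] st 7 by auto
        have "dist (\<gamma> s) (\<gamma> t) = dist (\<gamma> (4 * s - 3)) (\<gamma> (4 * t - 3)) / 2"
          using st 7 by (simp add: \<gamma>4[of s] \<gamma>4[of t] half)
        then show ?thesis
          using u st 7
          by (intro bexI[of _ "u / 4 + 3 / 4"])
            (simp_all add: F4[of s] F4[of t] F4[of "u / 4 + 3 / 4"] add_divide_distrib)
      qed
    qed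
  qed (use K assms in simp_all)
  then show ?thesis using QD assms by blast
qed

section \<open>Equivalence of the curve with hypotenuse and legs\<close>

text \<open>On the segment the height is the parameter itself, and \<open>F\<close> also ends at 1.
  A point of the segment and a point of the curve are compared through the attachment point that
  \<open>dist_base_le\<close> provides on the base.\<close>

lemma segment_equivalent: "tree_like_equivalent (linepath 0 1) \<gamma>"
proof (rule tree_like_equivalentI[where A = "\<lambda>x. x" and F = F])
  have lp: "linepath 0 1 x = complex_of_real x" for x
    by (simp add: linepath_def scaleR_conv_of_real)
  show "continuous_on {0..1} F"
    using path_F by (simp add: path_def)
  show "F t \<ge> 0" if "t \<in> {0..1}" for t
    using norm_le_F[OF that] norm_ge_zero[of "\<gamma> t"] by linarith
  show "continuous_on {0..1} (\<lambda>x :: real. x)" "(0 :: real) = 0" "1 = F 1"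
    using F_ends by simp_all
  show "\<exists>u\<in>{s..t}. dist (linepath 0 1 s) (linepath 0 1 t :: complex) \<le> s + t - 2 * u + e"
    if "0 \<le> s" "s \<le> t" "t \<le> 1" "0 < e" for s t e :: real
    using that by (intro bexI[of _ s]) (simp_all add: lp dist_of_real dist_real_def)
  show "\<exists>m\<in>(\<lambda>x. x) ` {s..1} \<union> F ` {t..1}. dist (linepath 0 1 s) (\<gamma> t) \<le> s + F t - 2 * m + e"
    if st: "s \<in> {0..1}" "t \<in> {0..1}" and "0 < e" for s t e :: real
  proof -
    obtain v where v: "v \<in> {t..1}" "dist (\<gamma> t) (of_real (F v)) \<le> F t - F v + e"
      using dist_base_le[OF st(2) \<open>0 < e\<close>] by blast
    have "dist (of_real s) (\<gamma> t) \<le> dist s (F v) + dist (\<gamma> t) (of_real (F v))"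
      using dist_triangle2[of "of_real s" "\<gamma> t" "of_real (F v)"] by (simp add: dist_of_real)
    then have "dist (linepath 0 1 s) (\<gamma> t) \<le> s + F t - 2 * min s (F v) + e"
      using v(2) unfolding lp dist_real_def by linarith
    \<comment> \<open>If the minimum is \<open>s\<close>, it is a height on the rest of the segment;
      if it is \<open>F v\<close>, it is one on the rest of the curve.\<close>
    moreover have "min s (F v) \<in> (\<lambda>x. x) ` {s..1} \<union> F ` {t..1}"
      using v(1) st by (auto simp: min_def)
    ultimately show ?thesis by blast
  qed
qed (use path_\<gamma> \<gamma>_ends F_ends dist_\<gamma>_le in \<open>simp_all add: pathfinish_def\<close>)

text \<open>\<open>?S\<close> and \<open>?R\<close> carry the hypotenuse to the legs and \<gamma> to
  its own two halves, so the equivalence with the hypotenuse is transported twice and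
  joined.\<close>

lemma legs_equivalent:
  "tree_like_equivalent (linepath 0 ((1 + \<i>) / 2) +++ linepath ((1 + \<i>) / 2) 1) \<gamma>"
proof -
  let ?c = "(1 + \<i>) / 2" and ?d = "(1 - \<i>) / 2"
  let ?S = "\<lambda>z. ?c * cnj z" and ?R = "\<lambda>z. ?c + ?d * cnj z"
  have S: "1-lipschitz_on UNIV ?S" and R: "1-lipschitz_on UNIV ?R"
  proof -
    have *: "cmod ?c \<le> 1" "cmod ?d \<le> 1"
      by (simp_all add: norm_divide cmod_def power_divide sqrt2_less_2 less_imp_le)
    have "dist (a + b * cnj z) (a + b * cnj w) \<le> 1 * dist z w" if "cmod b \<le> 1" for a b z w
    proof -
      have "dist (a + b * cnj z) (a + b * cnj w) = cmod (b * cnj (z - w))"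
        by (simp add: dist_norm right_diff_distrib)
      also have "\<dots> \<le> 1 * cmod (z - w)"
        unfolding norm_mult complex_mod_cnj using that by (intro mult_right_mono) simp_all
      finally show ?thesis by (simp add: dist_norm)
    qed
    from this[OF *(1), of 0] this[OF *(2), of ?c] show "1-lipschitz_on UNIV ?S" "1-lipschitz_on UNIV ?R"
      by (auto intro!: lipschitz_onI)
  qed
  have "tree_like_equivalent (linepath 0 ?c) (\<lambda>t. ?S (\<gamma> t))"
    using segment_equivalent S
    by (rule tree_like_equivalent_image) (simp_all add: linepath_def scaleR_conv_of_real)
  moreover have "tree_like_equivalent (linepath ?c 1) (\<lambda>t. ?R (\<gamma> t))"
    using segment_equivalent R
    by (rule tree_like_equivalent_image)
      (simp_all add: linepath_def scaleR_conv_of_real complex_eq_iff field_simps)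
  ultimately have "tree_like_equivalent (linepath 0 ?c +++ linepath ?c 1)
      ((\<lambda>t. ?S (\<gamma> t)) +++ (\<lambda>t. ?R (\<gamma> t)))"
    by (rule tree_like_equivalent_join) simp
  \<comment> \<open>The identity serves to replace the join of the two copies by \<gamma>, with
    which it agrees on \<open>{0..1}\<close>.\<close>
  moreover have "1-lipschitz_on UNIV (\<lambda>z :: complex. z)"
    by (intro lipschitz_onI) simp_all
  ultimately show ?thesis
    by (rule tree_like_equivalent_image) (simp_all add: joinpaths_def \<gamma>_left \<gamma>_right)
qed

end

subsection \<open>The triangle in the plane\<close>

lemma path_isometry:
  assumes "\<And>x y. dist (f x) (f y) = dist x y"
  shows "path (f \<circ> \<alpha>) \<longleftrightarrow> path \<alpha>"
  unfolding path_def continuous_on_iff using assms by simp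

text \<open>Equal distances give domination in both directions. The converse direction is what
  transports the negative statements: reducedness and the failure of equivalence.\<close>

lemma tree_like_isometry:
  assumes iso: "\<And>x y. dist (f x) (f y) = dist x y"
  shows "tree_like (f \<circ> \<alpha>) \<longleftrightarrow> tree_like \<alpha>"
proof
  assume "tree_like (f \<circ> \<alpha>)"
  moreover from this have "path \<alpha>"
    using path_isometry[OF iso] by (auto simp: tree_like_def)
  ultimately show "tree_like \<alpha>"
    by (rule tree_like_dominated[where L = 1]) (simp_all add: iso)
next
  assume "tree_like \<alpha>"
  moreover from this have "path (f \<circ> \<alpha>)"
    using path_isometry[OF iso] by (auto simp: tree_like_def)
  ultimately show "tree_like (f \<circ> \<alpha>)"
    by (rule tree_like_dominated[where L = 1]) (simp_all add: iso)
qed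

lemma tree_like_equivalent_isometry:
  assumes iso: "\<And>x y. dist (f x) (f y) = dist x y"
  shows "tree_like_equivalent (f \<circ> \<alpha>) (f \<circ> \<beta>) \<longleftrightarrow> tree_like_equivalent \<alpha> \<beta>"
proof -
  have "f x = f y \<longleftrightarrow> x = y" for x y
    using iso[of x y] by (metis dist_eq_0_iff)
  moreover have "(f \<circ> \<alpha>) +++ reversepath (f \<circ> \<beta>) = f \<circ> (\<alpha> +++ reversepath \<beta>)"
    by (simp add: path_compose_join path_compose_reversepath)
  ultimately show ?thesis
    by (simp add: tree_like_equivalent_def path_isometry[OF iso] tree_like_isometry[OF iso]
        pathfinish_compose)
qed

lemma tree_like_reduced_isometry:
  assumes iso: "\<And>x y. dist (f x) (f y) = dist x y"
  shows "tree_like_reduced (f \<circ> \<alpha>) \<longleftrightarrow> tree_like_reduced \<alpha>"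
proof -
  have "tree_like (\<lambda>x. (f \<circ> \<alpha>) ((t - s) * x + s)) \<longleftrightarrow> tree_like (\<lambda>x. \<alpha> ((t - s) * x + s))" for s t
    using tree_like_isometry[OF iso, of "\<lambda>x. \<alpha> ((t - s) * x + s)"] by (simp add: comp_def)
  then show ?thesis
    by (simp add: tree_like_reduced_def path_isometry[OF iso])
qed

lemma in_linepath_image:
  assumes "z \<in> path_image (linepath a b)"
  obtains u where "0 \<le> u" "u \<le> 1" "z = (1 - complex_of_real u) * a + of_real u * b"
  using assms by (auto simp: closed_segment_def scaleR_conv_of_real)

text \<open>The sides lie on three lines that meet pairwise only in the vertices. The closed curve
  is written as the concatenation that tests the equivalence of hypotenuse and legs.\<close>

lemma triangle_arcs:
  defines "c \<equiv> (1 + \<i>) / 2"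
  shows "arc (linepath 0 c +++ linepath c 1)"
    and "simple_path (linepath 0 1 +++ reversepath (linepath 0 c +++ linepath c 1))"
proof -
  have c: "c \<noteq> 0" "c \<noteq> 1" "Re c = 1/2" "Im c = 1/2"
    by (auto simp: c_def complex_eq_iff)
  show arc: "arc (linepath 0 c +++ linepath c 1)"
  proof (rule arc_join)
    show "path_image (linepath 0 c) \<inter> path_image (linepath c 1) \<subseteq> {pathstart (linepath c 1)}"
    proof
      fix z assume z: "z \<in> path_image (linepath 0 c) \<inter> path_image (linepath c 1)"
      obtain u where u: "u \<le> 1" "z = (1 - complex_of_real u) * 0 + of_real u * c"
        using z by (blast elim: in_linepath_image)
      obtain v where v: "0 \<le> v" "z = (1 - complex_of_real v) * c + of_real v * 1"
        using z by (blast elim: in_linepath_image)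
      have "Re z = u / 2" "Im z = u / 2"
        using u(2) c by simp_all
      moreover have "Re z = 1 / 2 + v / 2" "Im z = 1 / 2 - v / 2"
        unfolding v(2) by (simp_all add: c diff_divide_distrib)
      ultimately have "u = 1" by linarith
      then show "z \<in> {pathstart (linepath c 1)}" using u(2) by simp
    qed
  qed (use c in \<open>simp_all\<close>)
  show "simple_path (linepath 0 1 +++ reversepath (linepath 0 c +++ linepath c 1))"
  proof (rule simple_path_join_loop)
    show "path_image (linepath 0 1) \<inter> path_image (reversepath (linepath 0 c +++ linepath c 1))
       \<subseteq> {pathstart (linepath 0 1), pathstart (reversepath (linepath 0 c +++ linepath c 1))}"
    proof
      fix z assume "z \<in> path_image (linepath 0 1) \<inter>
        path_image (reversepath (linepath 0 c +++ linepath c 1))"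
      then have z: "z \<in> path_image (linepath 0 1)"
        and "z \<in> path_image (linepath 0 c) \<or> z \<in> path_image (linepath c 1)"
        by (auto simp: path_image_join)
      then consider "z \<in> path_image (linepath 0 c)" | "z \<in> path_image (linepath c 1)" by blast
      moreover obtain w where w: "z = (1 - complex_of_real w) * 0 + of_real w * 1"
        using z by (blast elim: in_linepath_image)
      ultimately show "z \<in> {pathstart (linepath 0 1),
          pathstart (reversepath (linepath 0 c +++ linepath c 1))}"
      proof cases
        case 1
        then obtain u where u: "z = (1 - complex_of_real u) * 0 + of_real u * c"
          by (blast elim: in_linepath_image)
        \<comment> \<open>Points of the base have imaginary part 0, while this leg has imaginary
          part \<open>u / 2\<close>.\<close>
        with w have "u = 0" using c by (simp add: complex_eq_iff)
        then show ?thesis using u by simp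
      next
        case 2
        then obtain u where u: "z = (1 - complex_of_real u) * c + of_real u * 1"
          by (blast elim: in_linepath_image)
        with w have "u = 1" using c by (simp add: complex_eq_iff)
        then show ?thesis using u by simp
      qed
    qed
  qed (use arc in \<open>simp_all add: arc_reversepath\<close>)
qed

theorem theorem6p1:
  shows "\<exists>\<alpha> \<beta> \<gamma> :: real \<Rightarrow> real ^ 2.
           path \<alpha> \<and> path \<beta> \<and> path \<gamma> \<and>
           tree_like_equivalent \<alpha> \<gamma> \<and> tree_like_equivalent \<beta> \<gamma> \<and>
           \<not> tree_like_equivalent \<alpha> \<beta> \<and>
           tree_like_reduced \<alpha> \<and> tree_like_reduced \<beta>"
proof -
  obtain \<gamma> :: "real \<Rightarrow> complex" where \<gamma>: "path \<gamma>" "\<gamma> 0 = 0" "\<gamma> 1 = 1"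
    "\<And>t. \<lbrakk>0 \<le> t; t \<le> 1/2\<rbrakk> \<Longrightarrow> \<gamma> t = (1 + \<i>) / 2 * cnj (\<gamma> (2 * t))"
    "\<And>t. \<lbrakk>0 \<le> t; t \<le> 1\<rbrakk> \<Longrightarrow> \<gamma> (1 - t) = 1 - cnj (\<gamma> t)"
    by (rule polya_curve_exists) blast
  obtain F :: "real \<Rightarrow> real" where F: "path F" "F 0 = 0" "F 1 = 1"
    "\<And>t. \<lbrakk>0 \<le> t; t \<le> 1/4\<rbrakk> \<Longrightarrow> F t = F (4 * t) / 2"
    "\<And>t. \<lbrakk>1/4 \<le> t; t \<le> 1/2\<rbrakk> \<Longrightarrow> F t = (1 + F (4 * t - 1)) / 2"
    "\<And>t. \<lbrakk>1/2 \<le> t; t \<le> 3/4\<rbrakk> \<Longrightarrow> F t = (1 + F (3 - 4 * t)) / 2"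
    "\<And>t. \<lbrakk>3/4 \<le> t; t \<le> 1\<rbrakk> \<Longrightarrow> F t = (1 + F (4 * t - 3)) / 2"
    by (rule hyp_height_exists) blast
  interpret polya_curve \<gamma> F
    by unfold_locales (fact \<gamma> F)+
  let ?\<alpha> = "linepath 0 (1 :: complex)"
  let ?\<beta> = "linepath 0 ((1 + \<i>) / 2) +++ linepath ((1 + \<i>) / 2) 1"
  \<comment> \<open>The construction uses complex multiplication for its rotations; this isometry
    moves the finished example to \<open>real ^ 2\<close>.\<close>
  define f :: "complex \<Rightarrow> real ^ 2" where "f z = vector [Re z, Im z]" for z
  have iso: "dist (f z) (f w) = dist z w" for z w
    by (simp add: f_def dist_vec_def L2_set_def UNIV_2 dist_real_def dist_norm cmod_def)
  have "arc ?\<alpha>" "arc ?\<beta>"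
    using triangle_arcs(1) by simp_all
  moreover have "\<not> tree_like_equivalent ?\<alpha> ?\<beta>"
    using simple_path_imp_not_tree_like[OF triangle_arcs(2)]
    by (simp add: tree_like_equivalent_def)
  ultimately have "path (f \<circ> ?\<alpha>) \<and> path (f \<circ> ?\<beta>) \<and> path (f \<circ> \<gamma>) \<and>
      tree_like_equivalent (f \<circ> ?\<alpha>) (f \<circ> \<gamma>) \<and> tree_like_equivalent (f \<circ> ?\<beta>) (f \<circ> \<gamma>) \<and>
      \<not> tree_like_equivalent (f \<circ> ?\<alpha>) (f \<circ> ?\<beta>) \<and>
      tree_like_reduced (f \<circ> ?\<alpha>) \<and> tree_like_reduced (f \<circ> ?\<beta>)"
    using segment_equivalent legs_equivalent \<gamma>(1)
    by (simp only: path_isometry[OF iso] tree_like_equivalent_isometry[OF iso]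
        tree_like_reduced_isometry[OF iso] arc_imp_path arc_imp_tree_like_reduced simp_thms)
  then show ?thesis by blast
qed

end
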